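(* Let $\mathbf{A}=(a_{ij})\in \mathrm{M}(n,\mathbf{H})$ be Hermitian with $\det\mathbf{A}\neq 0$. Then there exist a unique right inverse matrix $(R\mathbf{A})^{-1}$ and a unique left inverse matrix $(L\mathbf{A})^{-1}$ of $\mathbf{A}$ (i.e. $\mathbf{A}\,(R\mathbf{A})^{-1}=\mathbf{I}_n$ and $(L\mathbf{A})^{-1}\mathbf{A}=\mathbf{I}_n$), they coincide, $(R\mathbf{A})^{-1}=(L\mathbf{A})^{-1}=:\mathbf{A}^{-1}$, and they have the determinantal representations $$(R\mathbf{A})^{-1}=\frac{1}{\det\mathbf{A}}\begin{pmatrix}R_{11}&R_{21}&\cdots&R_{n1}\\R_{12}&R_{22}&\cdots&R_{n2}\\ \cdots&\cdots&\cdots&\cdots\\R_{1n}&R_{2n}&\cdots&R_{nn}\end{pmatrix},\qquad (L\mathbf{A})^{-1}=\frac{1}{\det\mathbf{A}}\begin{pmatrix}L_{11}&L_{21}&\cdots&L_{n1}\\L_{12}&L_{22}&\cdots&L_{n2}\\ \cdots&\cdots&\cdots&\cdots\\L_{1n}&L_{2n}&\cdots&L_{nn}\end{pmatrix},$$ where $R_{ij}$ and $L_{ij}$ are the right and left $ij$-th cofactors of $\mathbf{A}$, which for $n\ge 2$ are given as follows. For $i\ne j$, $R_{ij}=-\mathrm{rdet}_{k}\,\mathbf{A}^{ii}_{.j}(\mathbf{a}_{.i})$ with $k=j$ if $i>j$ and $k=j-1$ if $i<j$, and $L_{ij}=-\mathrm{cdet}_{k}\,\mathbf{A}^{jj}_{i.}(\mathbf{a}_{j.})$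 with $k=i$ if $j>i$ and $k=i-1$ if $j<i$. For $i=j$, $R_{ii}=\mathrm{rdet}_k\,\mathbf{A}^{ii}$ and $L_{ii}=\mathrm{cdet}_k\,\mathbf{A}^{ii}$, where $k$ is the row (column) of $\mathbf{A}^{ii}$ coming from the row (column) of $\mathbf{A}$ with index $\min(\{1,\dots,n\}\setminus\{i\})$.
   Context: $\mathbf{H}$ denotes the coquaternions (split quaternions): the associative real algebra with basis $1,i,j,k$ and $i^2=-1$, $j^2=k^2=1$, $ij=-ji=k$, $jk=-kj=-i$, $ik=-ki=-j$. The conjugate of $q=q_0+q_1i+q_2j+q_3k$ is $\overline{q}=q_0-q_1i-q_2j-q_3k$. $\mathrm{M}(n,\mathbf{H})$ is the ring of $n\times n$ matrices over $\mathbf{H}$. $\mathbf{A}^*=(\overline{a_{ji}})$ is the conjugate transpose of $\mathbf{A}=(a_{ij})$, and $\mathbf{A}$ is Hermitian if $\mathbf{A}^*=\mathbf{A}$. Row and column determinants. For a cycle $\gamma$ (possibly a fixed point) of a permutation and an element $s$ of $\gamma$, put $a_\gamma^{(s)}=a_{s\,\gamma(s)}\,a_{\gamma(s)\,\gamma^2(s)}\cdots a_{\gamma^{-1}(s)\,s}$ (equal to $a_{ss}$ for a fixed point). Given an index $i$, write $\sigma\in S_n$ as a product of its $r$ disjoint cycles (fixed points included) $\gamma_1,\dots,\gamma_r$, where $\gamma_1$ contains $i$ and the minimal elements $m_t$ of $\gamma_t$ satisfy $m_2<m_3<\dots<m_r$. Then $\mathrm{rdet}_i\,\mathbf{A}=\sum_{\sigma\in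 S_n}(-1)^{n-r}a_{\gamma_1}^{(i)}a_{\gamma_2}^{(m_2)}\cdots a_{\gamma_r}^{(m_r)}$ and $\mathrm{cdet}_i\,\mathbf{A}=\sum_{\sigma\in S_n}(-1)^{n-r}a_{\gamma_r}^{(m_r)}\cdots a_{\gamma_2}^{(m_2)}a_{\gamma_1}^{(i)}$ (factors multiplied in the order written). For Hermitian $\mathbf{A}$ it is known that all $\mathrm{rdet}_i\,\mathbf{A}$ and $\mathrm{cdet}_i\,\mathbf{A}$ coincide and are real; the common value is denoted $\det\mathbf{A}$. Cofactors. The right $ij$-th cofactor $R_{ij}$ is defined by $\mathrm{rdet}_i\,\mathbf{A}=\sum_j a_{ij}R_{ij}$, where $a_{ij}R_{ij}$ is the sum of the signed monomials of $\mathrm{rdet}_i\,\mathbf{A}$ whose leftmost factor is $a_{ij}$ ($R_{ij}$ is obtained by deleting that factor). The left $ij$-th cofactor $L_{ij}$ is defined by $\mathrm{cdet}_j\,\mathbf{A}=\sum_i L_{ij}a_{ij}$, where $L_{ij}a_{ij}$ is the sum of the signed monomials whose rightmost factor is $a_{ij}$. Notation: $\mathbf{a}_{i.}$, $\mathbf{a}_{.j}$ are the $i$-th row and $j$-th column of $\mathbf{A}$; $\mathbf{A}^{ii}$ is $\mathbf{A}$ with row $i$ and column $i$ deleted; $\mathbf{A}^{ii}_{.j}(\mathbf{a}_{.i})$ is obtained from $\mathbf{A}$ by replacing column $j$ with column $i$ and then deleting row $i$ and column $i$; $\mathbf{A}^{jj}_{i.}(\mathbf{a}_{j.})$ is obtained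 from $\mathbf{A}$ by replacing row $i$ with row $j$ and then deleting row $j$ and column $j$. For $i\neq j$ the index $k$ in the formulas is the position in the resulting $(n-1)\times(n-1)$ matrix. *)

theory Defs
  imports
    Complex_Main
    "HOL-Combinatorics.Cycles"
    "Jordan_Normal_Form.Determinant"
begin

section \<open>Coquaternions (split quaternions)\<close>

datatype coquat = Coquat (Cq0: real) (Cq1: real) (Cq2: real) (Cq3: real)

lemma coquat_eq_iff:
  "p = q \<longleftrightarrow> Cq0 p = Cq0 q \<and> Cq1 p = Cq1 q \<and> Cq2 p = Cq2 q \<and> Cq3 p = Cq3 q"
  by (auto intro: coquat.expand)

instantiation coquat :: real_algebra_1
begin

definition "0 = Coquat 0 0 0 0"
definition "1 = Coquat 1 0 0 0"
definition "p + q = Coquat (Cq0 p + Cq0 q) (Cq1 p + Cq1 q) (Cq2 p + Cq2 q) (Cq3 p + Cq3 q)"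
definition "- p = Coquat (- Cq0 p) (- Cq1 p) (- Cq2 p) (- Cq3 p)"
definition "p - q = Coquat (Cq0 p - Cq0 q) (Cq1 p - Cq1 q) (Cq2 p - Cq2 q) (Cq3 p - Cq3 q)"
definition "c *\<^sub>R p = Coquat (c * Cq0 p) (c * Cq1 p) (c * Cq2 p) (c * Cq3 p)"
definition "p * q = Coquat
  (Cq0 p * Cq0 q - Cq1 p * Cq1 q + Cq2 p * Cq2 q + Cq3 p * Cq3 q)
  (Cq0 p * Cq1 q + Cq1 p * Cq0 q - Cq2 p * Cq3 q + Cq3 p * Cq2 q)
  (Cq0 p * Cq2 q + Cq2 p * Cq0 q - Cq1 p * Cq3 q + Cq3 p * Cq1 q)
  (Cq0 p * Cq3 q + Cq3 p * Cq0 q + Cq1 p * Cq2 q - Cq2 p * Cq1 q)"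

lemmas coquat_ops_defs =
  zero_coquat_def one_coquat_def plus_coquat_def uminus_coquat_def minus_coquat_def
  scaleR_coquat_def times_coquat_def

instance
  by standard (simp_all add: coquat_ops_defs coquat_eq_iff algebra_simps)

end

lemma coquat_basis_mult:
  defines "i \<equiv> Coquat 0 1 0 0" and "j \<equiv> Coquat 0 0 1 0" and "k \<equiv> Coquat 0 0 0 1"
  shows "i * i = - 1" "j * j = 1" "k * k = 1"
    and "i * j = k" "j * i = - k" "j * k = - i" "k * j = i" "i * k = - j" "k * i = j"
  by (simp_all add: i_def j_def k_def coquat_ops_defs)

definition coquat_cnj :: "coquat \<Rightarrow> coquat" where
  "coquat_cnj q = Coquat (Cq0 q) (- Cq1 q) (- Cq2 q) (- Cq3 q)"

definition coquat_adjoint :: "coquat mat \<Rightarrow> coquat mat" where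
  "coquat_adjoint A = map_mat coquat_cnj (transpose_mat A)"

definition coquat_hermitian :: "coquat mat \<Rightarrow> bool" where
  "coquat_hermitian A \<longleftrightarrow> coquat_adjoint A = A"


section \<open>Row and column determinants\<close>

text \<open>
  Rows and columns are indexed from \<open>0\<close>, as everywhere for this matrix type.  Since the entries
  do not commute, a monomial of a row or column determinant is represented by the list of the
  positions \<open>(s, t)\<close> of its factors \<open>a\<^sub>s\<^sub>t\<close>, in the order of multiplication.
\<close>

definition word_prod :: "'a::monoid_mult mat \<Rightarrow> (nat \<times> nat) list \<Rightarrow> 'a" where
  "word_prod A w = prod_list (map (\<lambda>p. A $$ p) w)"

definition cycle_word :: "(nat \<Rightarrow> nat) \<Rightarrow> nat \<Rightarrow> (nat \<times> nat) list" where
  "cycle_word \<sigma> s = map (\<lambda>t. (t, \<sigma> t)) (support \<sigma> s)"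

definition cycle_sets :: "nat \<Rightarrow> (nat \<Rightarrow> nat) \<Rightarrow> nat set set" where
  "cycle_sets n \<sigma> = (\<lambda>s. set (support \<sigma> s)) ` {0..<n}"

text \<open>The list \<open>[i, m\<^sub>2, \<dots>, m\<^sub>r]\<close> of the points at which the cycles are opened.\<close>

definition cycle_starts :: "nat \<Rightarrow> nat \<Rightarrow> (nat \<Rightarrow> nat) \<Rightarrow> nat list" where
  "cycle_starts n i \<sigma> = i # sorted_list_of_set (Min ` {C \<in> cycle_sets n \<sigma>. i \<notin> C})"

definition rdet_word :: "nat \<Rightarrow> nat \<Rightarrow> (nat \<Rightarrow> nat) \<Rightarrow> (nat \<times> nat) list" where
  "rdet_word n i \<sigma> = concat (map (cycle_word \<sigma>) (cycle_starts n i \<sigma>))"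

definition cdet_word :: "nat \<Rightarrow> nat \<Rightarrow> (nat \<Rightarrow> nat) \<Rightarrow> (nat \<times> nat) list" where
  "cdet_word n i \<sigma> = concat (map (cycle_word \<sigma>) (rev (cycle_starts n i \<sigma>)))"

definition cycle_sign :: "nat \<Rightarrow> (nat \<Rightarrow> nat) \<Rightarrow> 'a::ring_1" where
  "cycle_sign n \<sigma> = (- 1) ^ (n - card (cycle_sets n \<sigma>))"

definition rdet :: "nat \<Rightarrow> 'a::ring_1 mat \<Rightarrow> 'a" where
  "rdet i A = (let n = dim_row A in
     \<Sum>\<sigma> | \<sigma> permutes {0..<n}. cycle_sign n \<sigma> * word_prod A (rdet_word n i \<sigma>))"

definition cdet :: "nat \<Rightarrow> 'a::ring_1 mat \<Rightarrow> 'a" where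
  "cdet i A = (let n = dim_row A in
     \<Sum>\<sigma> | \<sigma> permutes {0..<n}. cycle_sign n \<sigma> * word_prod A (cdet_word n i \<sigma>))"

text \<open>The common real value of all row and column determinants of a (nonempty) Hermitian matrix.\<close>

definition hermitian_det :: "coquat mat \<Rightarrow> real" where
  "hermitian_det A =
     (THE d. \<forall>i<dim_row A. rdet i A = of_real d \<and> cdet i A = of_real d)"


section \<open>Cofactors\<close>

definition right_cofactor :: "'a::ring_1 mat \<Rightarrow> nat \<Rightarrow> nat \<Rightarrow> 'a" where
  "right_cofactor A i j = (let n = dim_row A in
     \<Sum>\<sigma> | \<sigma> permutes {0..<n} \<and> hd (rdet_word n i \<sigma>) = (i, j).
       cycle_sign n \<sigma> * word_prod A (tl (rdet_word n i \<sigma>)))"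

definition left_cofactor :: "'a::ring_1 mat \<Rightarrow> nat \<Rightarrow> nat \<Rightarrow> 'a" where
  "left_cofactor A i j = (let n = dim_row A in
     \<Sum>\<sigma> | \<sigma> permutes {0..<n} \<and> last (cdet_word n j \<sigma>) = (i, j).
       cycle_sign n \<sigma> * word_prod A (butlast (cdet_word n j \<sigma>)))"

definition replace_row :: "'a mat \<Rightarrow> 'a vec \<Rightarrow> nat \<Rightarrow> 'a mat" where
  "replace_row A b k =
     mat (dim_row A) (dim_col A) (\<lambda>(i, j). if i = k then b $ j else A $$ (i, j))"

text \<open>The position that the index \<open>j \<noteq> i\<close> gets once the index \<open>i\<close> has been deleted.\<close>

definition delete_pos :: "nat \<Rightarrow> nat \<Rightarrow> nat" where
  "delete_pos i j = (if j < i then j else j - 1)"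


end

theory Submission
  imports Defs
begin

text \<open>
  Splitting off the cycle \<open>i # xs\<close> through \<open>i\<close> turns a row determinant into a sum over the lists \<open>xs\<close> of
  distinct indices, with the determinant of the remaining indices as a factor.  For a Hermitian matrix
  the reversal of \<open>xs\<close> conjugates the cycle product, so by induction all these determinants are real.
  The real part of a product is invariant under rotation; hence, expanding once more along \<open>j\<close> when the
  cycle of \<open>i\<close> avoids \<open>j\<close>, the determinants along \<open>i\<close> and along \<open>j\<close> agree.  If row \<open>i\<close> is replaced by row
  \<open>k \<noteq> i\<close>, the same second expansion along \<open>k\<close> gives each walk \<open>k, ys, k, xs, i\<close> twice with opposite signs:
  once as a cycle through \<open>k\<close> followed by a path from \<open>k\<close> to \<open>i\<close>, and once as a single path that visits
  \<open>k\<close>.  So the right cofactors give a right inverse.  Conjugation exchanges row and column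
  determinants, which yields the left inverse.
\<close>

section \<open>Cycle words, walks and expansions over an arbitrary index set\<close>

text \<open>Removing a cycle from \<open>{0..<n}\<close> leaves a set that need not be an interval,
  so the cycles are taken over any index set \<open>S\<close>; the inductions below run over such
  sets.\<close>

definition cycles_on :: "nat set \<Rightarrow> (nat \<Rightarrow> nat) \<Rightarrow> nat set set" where
  "cycles_on S \<sigma> = (\<lambda>s. set (support \<sigma> s)) ` S"

definition cycles_word :: "nat set \<Rightarrow> (nat \<Rightarrow> nat) \<Rightarrow> (nat \<times> nat) list" where
  "cycles_word S \<sigma> = concat (map (cycle_word \<sigma>) (sorted_list_of_set (Min ` cycles_on S \<sigma>)))"

text \<open>The row determinant on the index set \<open>S\<close> with every cycle opened at its minimum.\<close>

definition cycles_det :: "(nat \<times> nat \<Rightarrow> 'a::ring_1) \<Rightarrow> nat set \<Rightarrow> 'a" where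
  "cycles_det a S = (\<Sum>\<sigma> | \<sigma> permutes S.
     (- 1) ^ (card S - card (cycles_on S \<sigma>)) * prod_list (map a (cycles_word S \<sigma>)))"

text \<open>These are the steps of the walk from \<open>x\<close> through \<open>ys\<close> to
  \<open>z\<close>. Keeping both ends apart from \<open>ys\<close> treats closed cycles
  (\<open>z = x\<close>) and open paths alike.\<close>

fun path_word :: "nat \<Rightarrow> nat list \<Rightarrow> nat \<Rightarrow> (nat \<times> nat) list" where
  "path_word x [] z = [(x, z)]"
| "path_word x (y # ys) z = (x, y) # path_word y ys z"

definition path_prod :: "(nat \<times> nat \<Rightarrow> 'a::monoid_mult) \<Rightarrow> nat \<Rightarrow> nat list \<Rightarrow> nat \<Rightarrow> 'a" where
  "path_prod a x ys z = prod_list (map a (path_word x ys z))"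

text \<open>With \<open>T = S - {i}\<close> the lists encode the cycles through \<open>i\<close> in
  \<open>S\<close>: each is written uniquely as \<open>i # xs\<close>, and the empty list stands for
  a fixed point.\<close>

definition dlists :: "'a set \<Rightarrow> 'a list set" where
  "dlists T = {xs. set xs \<subseteq> T \<and> distinct xs}"

text \<open>
  The cycle through \<open>i\<close> is \<open>i # xs\<close>, but its first factor is taken from row \<open>k\<close>: this is the \<open>i\<close>-th row
  determinant after row \<open>i\<close> has been replaced by row \<open>k\<close>.
\<close>

definition row_expansion :: "(nat \<times> nat \<Rightarrow> 'a::ring_1) \<Rightarrow> nat set \<Rightarrow> nat \<Rightarrow> nat \<Rightarrow> 'a" where
  "row_expansion a S k i = (\<Sum>xs\<in>dlists (S - {i}).
     (- 1) ^ length xs * path_prod a k xs i * cycles_det a (S - set (i # xs)))"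

lemma finite_dlists: "finite T \<Longrightarrow> finite (dlists T)"
  unfolding dlists_def by (rule finite_subset_distinct)

lemma path_word_zip: "path_word x ys z = zip (x # ys) (ys @ [z])"
  by (induction x ys z rule: path_word.induct) auto

section \<open>Splitting a permutation at the cycle through a point\<close>

lemma support_nonempty:
  assumes "permutation \<sigma>"
  shows "support \<sigma> s = s # tl (support \<sigma> s)"
  using least_power_of_permutation(2)[OF assms, of s] by (simp add: upt_conv_Cons)

text \<open>Describes how adjoining a disjoint cycle to \<open>\<tau>\<close> changes supports,
  signs and words; sums over permutations are later reindexed by the pairs
  \<open>(xs, \<tau>)\<close>.\<close>

locale cycle_extension =
  fixes S' :: "nat set" and \<tau> \<sigma> :: "nat \<Rightarrow> nat" and i :: nat and xs :: "nat list"
  assumes finite: "finite S'" and perm: "\<tau> permutes S'"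
    and dist: "distinct (i # xs)" and disj: "set (i # xs) \<inter> S' = {}"
    and \<sigma>: "\<sigma> = cycle_of_list (i # xs) \<circ> \<tau>"
begin

lemma permutes: "\<sigma> permutes (set (i # xs) \<union> S')"
  unfolding \<sigma> using perm cycle_permutes[of "i # xs"]
  by (meson permutes_compose permutes_subset sup_ge1 sup_ge2)

lemma permutation: "permutation \<sigma>"
  using permutes finite unfolding permutation_permutes by (meson finite_UnI finite_set)

text \<open>The \<open>\<tau>\<close>-orbit of \<open>s\<close> never leaves \<open>S'\<close>,
  where the adjoined cycle acts as the identity.\<close>

lemma funpow_outside:
  assumes "s \<in> S'" shows "(\<sigma> ^^ k) s = (\<tau> ^^ k) s"
proof (induction k)
  case (Suc k)
  have "(\<tau> ^^ Suc k) s \<in> S'"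
    using assms permutes_in_image[OF permutes_funpow[OF perm]] by blast
  then have "(\<tau> ^^ Suc k) s \<notin> set (i # xs)" using disj by blast
  then have "cycle_of_list (i # xs) ((\<tau> ^^ Suc k) s) = (\<tau> ^^ Suc k) s"
    by (rule id_outside_supp)
  then show ?case using Suc by (simp add: \<sigma>)
qed simp

lemma support_outside:
  assumes "s \<in> S'" shows "support \<sigma> s = support \<tau> s"
  using funpow_outside[OF assms] by (simp add: least_power_def)

text \<open>Powers of the cycle act on its list as rotations, and \<open>i\<close> is the head of
  that list.\<close>

lemma cycle_of_list_funpow:
  "(cycle_of_list (i # xs) ^^ k) i = (i # xs) ! (k mod length (i # xs))"
proof -
  have "(cycle_of_list (i # xs) ^^ k) i = hd (map (cycle_of_list (i # xs) ^^ k) (i # xs))"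
    by simp
  also have "\<dots> = hd (rotate k (i # xs))"
    unfolding cyclic_rotation[OF dist] ..
  also have "\<dots> = (i # xs) ! (k mod length (i # xs))"
    by (rule hd_rotate_conv_nth) simp
  finally show ?thesis .
qed

lemma funpow_inside: "(\<sigma> ^^ k) i = (i # xs) ! (k mod length (i # xs))"
proof -
  have "(\<sigma> ^^ k) i = (cycle_of_list (i # xs) ^^ k) i"
  proof (induction k)
    case (Suc k)
    have "(cycle_of_list (i # xs) ^^ k) i \<in> set (i # xs)"
      unfolding cycle_of_list_funpow by (rule nth_mem) simp
    then have "\<tau> ((cycle_of_list (i # xs) ^^ k) i) = (cycle_of_list (i # xs) ^^ k) i"
      using disj permutes_not_in[OF perm] by blast
    then show ?case using Suc by (simp add: \<sigma>)
  qed simp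
  then show ?thesis by (simp only: cycle_of_list_funpow)
qed

lemma least_power_inside: "least_power \<sigma> i = length (i # xs)"
  unfolding least_power_def
proof (rule Least_equality)
  show "(\<sigma> ^^ length (i # xs)) i = i \<and> 0 < length (i # xs)"
    unfolding funpow_inside by simp
next
  fix k assume k: "(\<sigma> ^^ k) i = i \<and> 0 < k"
  then have "(i # xs) ! (k mod length (i # xs)) = (i # xs) ! 0"
    unfolding funpow_inside by simp
  \<comment> \<open>By distinctness \<open>i\<close> occurs at position 0 alone, so every return
    time is a multiple of the cycle length.\<close>
  then have "k mod length (i # xs) = 0"
    using dist nth_eq_iff_index_eq[OF dist, of "k mod length (i # xs)" 0] by simp
  then show "length (i # xs) \<le> k" using k by (auto intro: dvd_imp_le)
qed

lemma support_inside: "support \<sigma> i = i # xs"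
  unfolding least_power_inside
  by (rule nth_equalityI) (simp_all only: funpow_inside length_map length_upt nth_map_upt, simp_all)

text \<open>Supports of a permutation are equal or disjoint, and \<open>s\<close> lies in the
  support of \<open>i\<close>.\<close>

lemma set_support_inside:
  assumes "s \<in> set (i # xs)" shows "set (support \<sigma> s) = set (i # xs)"
proof -
  have "s \<in> set (support \<sigma> i)" using assms by (simp only: support_inside)
  then have "set (support \<sigma> s) \<inter> set (support \<sigma> i) \<noteq> {}"
    using disjoint_support'[OF permutation] by blast
  then have "set (support \<sigma> s) = set (support \<sigma> i)"
    using disjoint_support[OF permutation] by (meson UNIV_I disjoint_def image_iff)
  then show ?thesis by (simp only: support_inside)
qed

lemma cycles_on_eq:
  "cycles_on (set (i # xs) \<union> S') \<sigma> = insert (set (i # xs)) (cycles_on S' \<tau>)"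
proof -
  have "(\<lambda>s. set (support \<sigma> s)) ` set (i # xs) = {set (i # xs)}"
    using set_support_inside by force
  moreover have "(\<lambda>s. set (support \<sigma> s)) ` S' = cycles_on S' \<tau>"
    unfolding cycles_on_def by (rule image_cong[OF refl]) (simp only: support_outside)
  ultimately show ?thesis unfolding cycles_on_def image_Un by (simp only: insert_is_Un[symmetric])
qed

lemma cycles_on_subset:
  assumes "C \<in> cycles_on S' \<tau>" shows "C \<subseteq> S'"
  using assms permutes_in_image[OF permutes_funpow[OF perm]] unfolding cycles_on_def by auto

lemma cycles_on_nonempty:
  assumes "C \<in> cycles_on S' \<tau>" shows "C \<noteq> {}"
proof -
  have "permutation \<tau>" using perm finite permutation_permutes by blast
  then show ?thesis
    using assms least_power_of_permutation(2)[of \<tau>] unfolding cycles_on_def by auto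
qed

lemma other_cycles:
  "{C \<in> cycles_on (set (i # xs) \<union> S') \<sigma>. i \<notin> C} = cycles_on S' \<tau>"
proof -
  have "i \<notin> S'" using disj by auto
  then show ?thesis unfolding cycles_on_eq using cycles_on_subset by auto
qed

lemma card_cycles_on:
  "card (cycles_on (set (i # xs) \<union> S') \<sigma>) = Suc (card (cycles_on S' \<tau>))"
proof -
  have "set (i # xs) \<notin> cycles_on S' \<tau>"
    using cycles_on_subset disj by fastforce
  moreover have "finite (cycles_on S' \<tau>)" using finite by (simp add: cycles_on_def)
  ultimately show ?thesis unfolding cycles_on_eq by simp
qed

text \<open>The new cycle brings \<open>Suc (length xs)\<close> points but only one cycle, so points
  minus cycles grows by \<open>length xs\<close>.\<close>

lemma sign_exponent:
  "card (set (i # xs) \<union> S') - card (cycles_on (set (i # xs) \<union> S') \<sigma>)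
   = length xs + (card S' - card (cycles_on S' \<tau>))"
proof -
  have "card (set (i # xs) \<union> S') = length (i # xs) + card S'"
    using card_Un_disjoint[OF _ finite disj] distinct_card[OF dist] by simp
  \<comment> \<open>This bound keeps the natural-number subtraction from being truncated.\<close>
  moreover have "card (cycles_on S' \<tau>) \<le> card S'"
    unfolding cycles_on_def using finite by (rule card_image_le)
  ultimately show ?thesis using card_cycles_on by simp
qed

text \<open>Applying \<open>\<sigma>\<close> to \<open>i # xs\<close> rotates it to
  \<open>xs @ [i]\<close>, and zipping the two lists gives the steps of the closed walk.\<close>

lemma cycle_word_inside: "cycle_word \<sigma> i = path_word i xs i"
proof -
  have "map \<sigma> (i # xs) = map (cycle_of_list (i # xs)) (i # xs)"
  proof (rule map_cong[OF refl])
    fix x assume "x \<in> set (i # xs)"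
    then have "\<tau> x = x" using disj permutes_not_in[OF perm] by blast
    then show "\<sigma> x = cycle_of_list (i # xs) x" by (simp add: \<sigma>)
  qed
  also have "\<dots> = xs @ [i]"
    using cyclic_rotation[OF dist, of 1] by simp
  finally have "map \<sigma> (i # xs) = xs @ [i]" .
  then show ?thesis
    unfolding cycle_word_def support_inside path_word_zip
    by (simp only: zip_map2 zip_same_conv_map map_map o_def flip: \<open>map \<sigma> (i # xs) = xs @ [i]\<close>) simp
qed

lemma cycle_word_outside:
  assumes "s \<in> S'" shows "cycle_word \<sigma> s = cycle_word \<tau> s"
proof -
  have "\<sigma> t = \<tau> t" if "t \<in> set (support \<tau> s)" for t
  proof -
    have "t \<in> S'" using that assms cycles_on_subset unfolding cycles_on_def by blast
    then show ?thesis using funpow_outside[of t 1] by simp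
  qed
  then show ?thesis unfolding cycle_word_def support_outside[OF assms] by (intro map_cong[OF refl]) (simp only:)
qed

lemma Min_cycles_on: "Min ` cycles_on S' \<tau> \<subseteq> S'"
proof clarify
  fix C assume "C \<in> cycles_on S' \<tau>"
  then have "C \<subseteq> S'" "C \<noteq> {}" by (rule cycles_on_subset, rule cycles_on_nonempty)
  then show "Min C \<in> S'" using Min_in[OF finite_subset[OF _ finite]] by blast
qed

lemma concat_cycle_words:
  "concat (map (cycle_word \<sigma>) (sorted_list_of_set (Min ` cycles_on S' \<tau>))) = cycles_word S' \<tau>"
proof -
  have "finite (cycles_on S' \<tau>)" using finite by (simp add: cycles_on_def)
  then have "map (cycle_word \<sigma>) (sorted_list_of_set (Min ` cycles_on S' \<tau>))
      = map (cycle_word \<tau>) (sorted_list_of_set (Min ` cycles_on S' \<tau>))"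
    using Min_cycles_on by (intro map_cong[OF refl] cycle_word_outside) auto
  then show ?thesis by (simp only: cycles_word_def)
qed

text \<open>As \<open>i\<close> is the least index, its cycle has the least minimum: the sorted
  starting points begin with \<open>i\<close>, and the cycle is opened there.\<close>

lemma cycles_word_eq:
  assumes "i = Min (set (i # xs) \<union> S')"
  shows "cycles_word (set (i # xs) \<union> S') \<sigma> = path_word i xs i @ cycles_word S' \<tau>"
proof -
  let ?M = "Min ` cycles_on S' \<tau>"
  have M: "finite ?M" "?M \<subseteq> S'"
    using finite Min_cycles_on by (simp_all add: cycles_on_def)
  have le: "i \<le> x" if "x \<in> set (i # xs) \<union> S'" for x
    using that finite by (subst assms) (rule Min_le, auto)
  have "Min (set (i # xs)) = i"
    by (rule Min_eqI) (auto intro: le)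
  then have "Min ` cycles_on (set (i # xs) \<union> S') \<sigma> = insert i ?M"
    unfolding cycles_on_eq by simp
  moreover have "i \<notin> ?M" using M disj by auto
  then have "sorted_list_of_set (insert i ?M) = i # sorted_list_of_set ?M"
    using M le by (simp add: insort_is_Cons subset_iff)
  ultimately show ?thesis
    using concat_cycle_words cycle_word_inside unfolding cycles_word_def[of "_ \<union> _"] by simp
qed

end

lemma dlists_extension:
  assumes "finite S" "i \<in> S" "xs \<in> dlists (S - {i})" "\<tau> permutes (S - set (i # xs))"
  shows "cycle_extension (S - set (i # xs)) \<tau> (cycle_of_list (i # xs) \<circ> \<tau>) i xs"
    and "set (i # xs) \<union> (S - set (i # xs)) = S"
  using assms by (auto simp: cycle_extension_def dlists_def)

text \<open>A permutation corresponds to its cycle through \<open>i\<close>, opened at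
  \<open>i\<close>, together with its restriction \<open>?rest \<sigma>\<close> to the other points;
  composing the two inverts this.\<close>

lemma sum_permutes_by_cycle:
  fixes F :: "(nat \<Rightarrow> nat) \<Rightarrow> 'a::comm_monoid_add"
  assumes S: "finite S" and i: "i \<in> S"
  shows "(\<Sum>\<sigma> | \<sigma> permutes S. F \<sigma>) =
    (\<Sum>xs\<in>dlists (S - {i}). \<Sum>\<tau> | \<tau> permutes (S - set (i # xs)). F (cycle_of_list (i # xs) \<circ> \<tau>))"
proof -
  let ?rest = "\<lambda>\<sigma> y. if y \<in> S - set (support \<sigma> i) then \<sigma> y else y"
  let ?P = "SIGMA xs:dlists (S - {i}). {\<tau>. \<tau> permutes (S - set (i # xs))}"
  have fwd: "cycle_of_list (i # tl (support \<sigma> i)) \<circ> ?rest \<sigma> = \<sigma>"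
    "(tl (support \<sigma> i), ?rest \<sigma>) \<in> ?P"
    if "\<sigma> permutes S" for \<sigma>
  proof -
    have \<sigma>: "permutation \<sigma>" "\<sigma> permutes S" using that S permutation_permutes by blast+
    note sup = support_nonempty[OF \<sigma>(1), of i]
    show "cycle_of_list (i # tl (support \<sigma> i)) \<circ> ?rest \<sigma> = \<sigma>"
    proof
      fix y
      consider "y \<in> S" "y \<notin> set (support \<sigma> i)" | "y \<in> set (support \<sigma> i)"
        | "y \<notin> S" "y \<notin> set (support \<sigma> i)" by blast
      then show "(cycle_of_list (i # tl (support \<sigma> i)) \<circ> ?rest \<sigma>) y = \<sigma> y"
        unfolding sup[symmetric]
      proof cases
        case 1
        \<comment> \<open>The support of \<open>y\<close> contains \<open>\<sigma> y\<close> and is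
          disjoint from that of \<open>i\<close>, so the outer cycle fixes
          \<open>\<sigma> y\<close>.\<close>
        have "(\<sigma> ^^ 1) y \<in> set (support \<sigma> y)"
          unfolding support_set[OF \<sigma>(1)] by blast
        then have "\<sigma> y \<notin> set (support \<sigma> i)"
          using 1 disjoint_support'[OF \<sigma>(1), of y i] by auto
        then show "(cycle_of_list (support \<sigma> i) \<circ> ?rest \<sigma>) y = \<sigma> y"
          using 1 id_outside_supp[of "\<sigma> y" "support \<sigma> i"] by (simp del: set_map)
      next
        case 2
        then show "(cycle_of_list (support \<sigma> i) \<circ> ?rest \<sigma>) y = \<sigma> y"
          using cycle_restrict[OF \<sigma>(1)] by (simp del: set_map)
      next
        case 3
        then show "(cycle_of_list (support \<sigma> i) \<circ> ?rest \<sigma>) y = \<sigma> y"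
          using id_outside_supp[of y "support \<sigma> i"] permutes_not_in[OF \<sigma>(2)] by (simp del: set_map)
      qed
    qed
    have "set (support \<sigma> i) \<subseteq> S"
      using i permutes_in_image[OF permutes_funpow[OF \<sigma>(2)]] by auto
    moreover have "distinct (support \<sigma> i)" by (rule cycle_of_permutation[OF \<sigma>(1)])
    ultimately have "tl (support \<sigma> i) \<in> dlists (S - {i})"
      using sup unfolding dlists_def
      by (smt (verit) distinct.simps(2) Diff_eq insert_subset list.simps(15) mem_Collect_eq subset_Diff_insert Diff_empty)
    moreover have "?rest \<sigma> permutes (S - set (i # tl (support \<sigma> i)))"
      using semidecomposition[OF \<sigma>(2) S, of i] sup by simp
    ultimately show "(tl (support \<sigma> i), ?rest \<sigma>) \<in> ?P" by blast
  qed
  have bwd: "cycle_of_list (i # xs) \<circ> \<tau> permutes S"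
    "tl (support (cycle_of_list (i # xs) \<circ> \<tau>) i) = xs"
    "?rest (cycle_of_list (i # xs) \<circ> \<tau>) = \<tau>"
    if "(xs, \<tau>) \<in> ?P" for xs \<tau>
  proof -
    have P: "xs \<in> dlists (S - {i})" "\<tau> permutes (S - set (i # xs))" using that by auto
    interpret cycle_extension "S - set (i # xs)" \<tau> "cycle_of_list (i # xs) \<circ> \<tau>" i xs
      by (rule dlists_extension[OF S i P])
    show "cycle_of_list (i # xs) \<circ> \<tau> permutes S" 
      using permutes dlists_extension(2)[OF S i P] by simp
    show "tl (support (cycle_of_list (i # xs) \<circ> \<tau>) i) = xs"
      by (simp only: support_inside list.sel)
    show "?rest (cycle_of_list (i # xs) \<circ> \<tau>) = \<tau>"
    proof
      fix y show "?rest (cycle_of_list (i # xs) \<circ> \<tau>) y = \<tau> y"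
        using funpow_outside[of y 1] permutes_not_in[OF perm, of y] unfolding support_inside by auto
    qed
  qed
  have "(\<Sum>\<sigma> | \<sigma> permutes S. F \<sigma>) = (\<Sum>(xs, \<tau>)\<in>?P. F (cycle_of_list (i # xs) \<circ> \<tau>))"
  proof (rule sum.reindex_bij_witness
      [where i = "\<lambda>(xs, \<tau>). cycle_of_list (i # xs) \<circ> \<tau>" and j = "\<lambda>\<sigma>. (tl (support \<sigma> i), ?rest \<sigma>)"])
    fix \<sigma> assume "\<sigma> \<in> {\<sigma>. \<sigma> permutes S}"
    then have \<sigma>: "\<sigma> permutes S" by simp
    show "(case (tl (support \<sigma> i), ?rest \<sigma>) of (xs, \<tau>) \<Rightarrow> cycle_of_list (i # xs) \<circ> \<tau>) = \<sigma>"
      unfolding prod.case by (rule fwd(1)[OF \<sigma>])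
    show "(tl (support \<sigma> i), ?rest \<sigma>) \<in> ?P" by (rule fwd(2)[OF \<sigma>])
    show "(case (tl (support \<sigma> i), ?rest \<sigma>) of (xs, \<tau>) \<Rightarrow> F (cycle_of_list (i # xs) \<circ> \<tau>)) = F \<sigma>"
      unfolding prod.case by (simp only: fwd(1)[OF \<sigma>])
  next
    fix p assume "p \<in> ?P"
    then obtain xs \<tau> where p: "p = (xs, \<tau>)" "(xs, \<tau>) \<in> ?P" by (cases p) blast
    show "(case p of (xs, \<tau>) \<Rightarrow> cycle_of_list (i # xs) \<circ> \<tau>) \<in> {\<sigma>. \<sigma> permutes S}"
      unfolding p(1) prod.case mem_Collect_eq by (rule bwd(1)[OF p(2)])
    show "(tl (support (case p of (xs, \<tau>) \<Rightarrow> cycle_of_list (i # xs) \<circ> \<tau>) i),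
        ?rest (case p of (xs, \<tau>) \<Rightarrow> cycle_of_list (i # xs) \<circ> \<tau>)) = p"
      unfolding p(1) prod.case by (simp only: bwd(2,3)[OF p(2)])
  qed
  also have "\<dots> = (\<Sum>xs\<in>dlists (S - {i}). \<Sum>\<tau> | \<tau> permutes (S - set (i # xs)).
      F (cycle_of_list (i # xs) \<circ> \<tau>))"
    using S by (subst sum.Sigma) (auto intro: finite_dlists finite_permutations)
  finally show ?thesis .
qed

section \<open>Row determinants and right cofactors as sums over cycles\<close>

lemma cycles_det_empty: "cycles_det a {} = 1"
  by (simp add: cycles_det_def cycles_on_def cycles_word_def)

lemma sign_commute: "(- 1 :: 'a::ring_1) ^ k * x = x * (- 1) ^ k"
  by (cases "even k") auto

text \<open>The cycle of the least index leads every word, so its walk factors out on the left. This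
  recursion drives the later inductions on \<open>card S\<close>.\<close>

lemma cycles_det_eq_row_expansion:
  assumes S: "finite S" "S \<noteq> {}"
  shows "cycles_det a S = row_expansion a S (Min S) (Min S)"
proof -
  let ?i = "Min S"
  have i: "?i \<in> S" using S by simp
  show ?thesis
    unfolding cycles_det_def[of a S] row_expansion_def sum_permutes_by_cycle[OF S(1) i]
  proof (rule sum.cong[OF refl])
    fix xs assume xs: "xs \<in> dlists (S - {?i})"
    let ?S' = "S - set (?i # xs)"
    have "(- 1) ^ (card S - card (cycles_on S (cycle_of_list (?i # xs) \<circ> \<tau>))) *
         prod_list (map a (cycles_word S (cycle_of_list (?i # xs) \<circ> \<tau>))) =
        (- 1) ^ length xs * path_prod a ?i xs ?i *
        ((- 1) ^ (card ?S' - card (cycles_on ?S' \<tau>)) * prod_list (map a (cycles_word ?S' \<tau>)))"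
      if \<tau>: "\<tau> permutes ?S'" for \<tau>
    proof -
      interpret cycle_extension ?S' \<tau> "cycle_of_list (?i # xs) \<circ> \<tau>" ?i xs
        by (rule dlists_extension[OF S(1) i xs \<tau>])
      have un: "set (?i # xs) \<union> ?S' = S" by (rule dlists_extension[OF S(1) i xs \<tau>])
      show ?thesis
        using sign_exponent cycles_word_eq unfolding un
        by (simp add: power_add path_prod_def mult.assoc,
            simp add: sign_commute[of _ "prod_list (map _ (path_word _ _ _))"] flip: mult.assoc)
    qed
    then show "(\<Sum>\<tau> | \<tau> permutes ?S'. (- 1) ^ (card S - card (cycles_on S (cycle_of_list (?i # xs) \<circ> \<tau>))) *
         prod_list (map a (cycles_word S (cycle_of_list (?i # xs) \<circ> \<tau>)))) =
        (- 1) ^ length xs * path_prod a ?i xs ?i * cycles_det a ?S'"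
      unfolding cycles_det_def sum_distrib_left by (intro sum.cong refl) simp
  qed
qed

lemma cycle_sets_eq: "cycle_sets n \<sigma> = cycles_on {0..<n} \<sigma>"
  by (simp add: cycle_sets_def cycles_on_def)

text \<open>The cycle of \<open>i\<close> comes first and the others follow by their minima, which
  is exactly the order used by \<open>cycles_word\<close> on the remaining indices.\<close>

lemma rdet_word_extension:
  assumes "i < n" "xs \<in> dlists ({0..<n} - {i})" "\<tau> permutes ({0..<n} - set (i # xs))"
  shows "rdet_word n i (cycle_of_list (i # xs) \<circ> \<tau>) =
           path_word i xs i @ cycles_word ({0..<n} - set (i # xs)) \<tau>"
    and "cycle_sign n (cycle_of_list (i # xs) \<circ> \<tau>) = (- 1) ^ length xs *
          (- 1) ^ (card ({0..<n} - set (i # xs)) - card (cycles_on ({0..<n} - set (i # xs)) \<tau>))"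
proof -
  let ?S' = "{0..<n} - set (i # xs)"
  have i: "i \<in> {0..<n}" using assms by simp
  interpret cycle_extension ?S' \<tau> "cycle_of_list (i # xs) \<circ> \<tau>" i xs
    by (rule dlists_extension[OF _ i assms(2,3)]) simp
  have un: "set (i # xs) \<union> ?S' = {0..<n}" by (rule dlists_extension[OF _ i assms(2,3)]) simp
  show "rdet_word n i (cycle_of_list (i # xs) \<circ> \<tau>) = path_word i xs i @ cycles_word ?S' \<tau>"
    using other_cycles concat_cycle_words cycle_word_inside unfolding un
    by (simp add: rdet_word_def cycle_starts_def cycle_sets_eq)
  show "cycle_sign n (cycle_of_list (i # xs) \<circ> \<tau>) =
     (- 1) ^ length xs * (- 1) ^ (card ?S' - card (cycles_on ?S' \<tau>))"
    using sign_exponent unfolding un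
    by (simp only: cycle_sign_def cycle_sets_eq card_atLeastLessThan diff_zero power_add)
qed

lemma rdet_eq_row_expansion:
  assumes A: "dim_row A = n" and i: "i < n"
  shows "rdet i A = row_expansion (($$) A) {0..<n} i i"
proof -
  have "i \<in> {0..<n}" using i by simp
  then show ?thesis
    unfolding rdet_def A Let_def row_expansion_def
      sum_permutes_by_cycle[OF finite_atLeastLessThan \<open>i \<in> {0..<n}\<close>]
    by (intro sum.cong refl)
      (simp add: cycles_det_def sum_distrib_left rdet_word_extension[OF i] word_prod_def path_prod_def
        mult.assoc, simp add: sign_commute[of _ "prod_list (map _ (path_word _ _ _))"] flip: mult.assoc)
qed

text \<open>The column of the leading factor is the successor of \<open>i\<close> in its cycle: the
  head of \<open>xs\<close>, or \<open>i\<close> itself if \<open>xs\<close> is empty. The term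
  \<open>hd (xs @ [i])\<close> covers both cases.\<close>

lemma right_cofactor_eq_sum:
  assumes A: "dim_row A = n" and i: "i < n"
  shows "right_cofactor A i j = (\<Sum>xs\<in>dlists ({0..<n} - {i}). if hd (xs @ [i]) = j then
     (- 1) ^ length xs * prod_list (map (($$) A) (tl (path_word i xs i)))
       * cycles_det (($$) A) ({0..<n} - set (i # xs)) else 0)"
proof -
  have iS: "i \<in> {0..<n}" using i by simp
  have hd: "hd (path_word i xs i @ w) = (i, j) \<longleftrightarrow> hd (xs @ [i]) = j"
    and tl: "tl (path_word i xs i @ w) = tl (path_word i xs i) @ w" for xs w
    by (cases xs; simp)+
  have "right_cofactor A i j = (\<Sum>\<sigma> | \<sigma> permutes {0..<n}. if hd (rdet_word n i \<sigma>) = (i, j) then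
     cycle_sign n \<sigma> * word_prod A (tl (rdet_word n i \<sigma>)) else 0)"
    unfolding right_cofactor_def A Let_def
    by (subst sum.inter_filter[OF finite_permutations[OF finite_atLeastLessThan], symmetric]) simp
  also have "\<dots> = (\<Sum>xs\<in>dlists ({0..<n} - {i}). if hd (xs @ [i]) = j then
     (- 1) ^ length xs * prod_list (map (($$) A) (tl (path_word i xs i)))
       * cycles_det (($$) A) ({0..<n} - set (i # xs)) else 0)"
    unfolding sum_permutes_by_cycle[OF finite_atLeastLessThan iS]
    by (intro sum.cong refl)
      (simp add: cycles_det_def sum_distrib_left rdet_word_extension[OF i] hd tl word_prod_def
        mult.assoc, simp add: sign_commute[of _ "prod_list (map _ (tl (path_word _ _ _)))"] flip: mult.assoc)
  finally show ?thesis .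
qed

lemma path_prod_Nil [simp]: "path_prod a x [] z = a (x, z)"
  and path_prod_Cons [simp]: "path_prod a x (y # ys) z = a (x, y) * path_prod a y ys z"
  by (simp_all add: path_prod_def)

lemma path_prod_append: "path_prod a x (ys @ y # zs) z = path_prod a x ys y * path_prod a y zs z"
  by (induction ys arbitrary: x) (simp_all add: mult.assoc)

text \<open>For each \<open>xs\<close> exactly one \<open>j\<close> contributes, and the entry from
  row \<open>k\<close> takes the place of the deleted leading factor.\<close>

lemma sum_right_cofactor:
  assumes A: "dim_row A = n" and i: "i < n"
  shows "(\<Sum>j<n. A $$ (k, j) * right_cofactor A i j) = row_expansion (($$) A) {0..<n} k i"
proof -
  have "(\<Sum>j<n. A $$ (k, j) * right_cofactor A i j) = (\<Sum>xs\<in>dlists ({0..<n} - {i}).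
      \<Sum>j<n. if hd (xs @ [i]) = j then A $$ (k, j) * ((- 1) ^ length xs
        * prod_list (map (($$) A) (tl (path_word i xs i)))
        * cycles_det (($$) A) ({0..<n} - set (i # xs))) else 0)"
    unfolding right_cofactor_eq_sum[OF A i] sum_distrib_left
    by (subst sum.swap) (intro sum.cong refl, simp)
  also have "\<dots> = row_expansion (($$) A) {0..<n} k i"
    unfolding row_expansion_def
  proof (rule sum.cong[OF refl])
    fix xs assume "xs \<in> dlists ({0..<n} - {i})"
    then have "hd (xs @ [i]) < n" using i by (cases xs) (auto simp: dlists_def)
    moreover have "A $$ (k, hd (xs @ [i])) * prod_list (map (($$) A) (tl (path_word i xs i)))
        = path_prod (($$) A) k xs i"
      by (cases xs) (simp_all add: path_prod_def)
    ultimately show "(\<Sum>j<n. if hd (xs @ [i]) = j then A $$ (k, j) * ((- 1) ^ length xs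
        * prod_list (map (($$) A) (tl (path_word i xs i)))
        * cycles_det (($$) A) ({0..<n} - set (i # xs))) else 0)
      = (- 1) ^ length xs * path_prod (($$) A) k xs i
        * cycles_det (($$) A) ({0..<n} - set (i # xs))"
      by (simp add: sign_commute mult.assoc flip: \<open>_ = path_prod _ _ _ _\<close>)
  qed
  finally show ?thesis .
qed

text \<open>Since \<open>i\<close> does not occur in \<open>xs\<close>, the leading factor is the
  diagonal entry only when \<open>i\<close> is a fixed point.\<close>

lemma right_cofactor_diag:
  assumes A: "dim_row A = n" and i: "i < n"
  shows "right_cofactor A i i = cycles_det (($$) A) ({0..<n} - {i})"
proof -
  have "hd (xs @ [i]) = i \<longleftrightarrow> xs = []" if "xs \<in> dlists ({0..<n} - {i})" for xs
    using that by (cases xs) (auto simp: dlists_def)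
  then have "right_cofactor A i i = (\<Sum>xs\<in>dlists ({0..<n} - {i}). if xs = [] then
     cycles_det (($$) A) ({0..<n} - {i}) else 0)"
    unfolding right_cofactor_eq_sum[OF A i] by (intro sum.cong refl) auto
  also have "\<dots> = cycles_det (($$) A) ({0..<n} - {i})"
    by (simp add: sum.delta finite_dlists) (simp add: dlists_def)
  finally show ?thesis .
qed

text \<open>The leading factor forces \<open>xs = j # ys\<close>, and the extra element gives the
  minus sign. What remains resembles the expansion along \<open>j\<close>, except that the walk ends
  at \<open>i\<close>; the column replacement will account for this.\<close>

lemma right_cofactor_off_diag:
  assumes A: "dim_row A = n" and ij: "i < n" "j < n" "i \<noteq> j"
  shows "right_cofactor A i j = - (\<Sum>ys\<in>dlists ({0..<n} - {i} - {j}).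
     (- 1) ^ length ys * path_prod (($$) A) j ys i * cycles_det (($$) A) ({0..<n} - {i} - set (j # ys)))"
proof -
  let ?T = "{0..<n} - {i}"
  let ?f = "\<lambda>xs. (- 1) ^ length xs * prod_list (map (($$) A) (tl (path_word i xs i)))
       * cycles_det (($$) A) ({0..<n} - set (i # xs))"
  have "right_cofactor A i j = sum ?f {xs \<in> dlists ?T. hd (xs @ [i]) = j}"
    unfolding right_cofactor_eq_sum[OF A ij(1)]
    by (rule sum.inter_filter[symmetric]) (simp add: finite_dlists)
  also have "{xs \<in> dlists ?T. hd (xs @ [i]) = j} = (#) j ` dlists (?T - {j})"
    using ij by (auto simp: dlists_def image_iff neq_Nil_conv) (case_tac x; auto)
  also have "sum ?f \<dots> = (\<Sum>ys\<in>dlists (?T - {j}). ?f (j # ys))"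
    by (subst sum.reindex) (auto simp: inj_on_def)
  also have "\<dots> = - (\<Sum>ys\<in>dlists ({0..<n} - {i} - {j}).
     (- 1) ^ length ys * path_prod (($$) A) j ys i * cycles_det (($$) A) ({0..<n} - {i} - set (j # ys)))"
    unfolding sum_negf[symmetric]
    by (intro sum.cong refl) (simp add: path_prod_def Diff_insert2[symmetric] Diff_insert[symmetric] insert_commute)
  finally show ?thesis .
qed

section \<open>Sums over pairs of disjoint lists\<close>

text \<open>The condition is symmetric in the two lists, so they may be interchanged under a
  sum.\<close>

definition dlist_pairs :: "'a set \<Rightarrow> ('a list \<times> 'a list) set" where
  "dlist_pairs T = {(xs, ys). distinct (xs @ ys) \<and> set (xs @ ys) \<subseteq> T}"

lemma sum_dlists_nested:
  assumes "finite T"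
  shows "(\<Sum>xs\<in>dlists T. \<Sum>ys\<in>dlists (T - set xs). G xs ys) = (\<Sum>(xs, ys)\<in>dlist_pairs T. G xs ys)"
proof -
  have "dlist_pairs T = (SIGMA xs:dlists T. dlists (T - set xs))"
    by (auto simp: dlist_pairs_def dlists_def)
  then show ?thesis
    using assms by (simp add: sum.Sigma finite_dlists)
qed

lemma sum_dlist_pairs_swap:
  "(\<Sum>(xs, ys)\<in>dlist_pairs T. G xs ys) = (\<Sum>(xs, ys)\<in>dlist_pairs T. G ys xs)"
  by (rule sum.reindex_bij_witness[where i = prod.swap and j = prod.swap]) (auto simp: dlist_pairs_def)

text \<open>A list either avoids \<open>j\<close> or is cut, in a unique way, at its only occurrence
  of \<open>j\<close>.\<close>

lemma sum_dlists_split: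
  assumes "finite T" and j: "j \<in> T"
  shows "(\<Sum>xs\<in>dlists T. F xs) =
    (\<Sum>xs\<in>dlists (T - {j}). F xs) + (\<Sum>(us, vs)\<in>dlist_pairs (T - {j}). F (us @ j # vs))"
proof -
  let ?f = "\<lambda>(us, vs). us @ j # vs"
  have eq: "dlists T = dlists (T - {j}) \<union> ?f ` dlist_pairs (T - {j})"
  proof (intro equalityI subsetI)
    fix xs assume xs: "xs \<in> dlists T"
    show "xs \<in> dlists (T - {j}) \<union> ?f ` dlist_pairs (T - {j})"
    proof (cases "j \<in> set xs")
      case True
      then obtain us vs where "xs = us @ j # vs" by (meson split_list)
      then show ?thesis using xs by (force simp: dlists_def dlist_pairs_def)
    qed (use xs in \<open>auto simp: dlists_def\<close>)
  qed (use j in \<open>auto simp: dlists_def dlist_pairs_def\<close>)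
  have inj: "inj_on ?f (dlist_pairs (T - {j}))"
  proof (rule inj_onI, clarify)
    fix us vs us' vs'
    assume "(us, vs) \<in> dlist_pairs (T - {j})" "(us', vs') \<in> dlist_pairs (T - {j})"
      and "us @ j # vs = us' @ j # vs'"
    moreover from this have "j \<notin> set us \<union> set vs" "j \<notin> set us' \<union> set vs'"
      by (auto simp: dlist_pairs_def)
    ultimately show "us = us' \<and> vs = vs'" by (simp add: append_Cons_eq_iff)
  qed
  have disj: "dlists (T - {j}) \<inter> ?f ` dlist_pairs (T - {j}) = {}"
    by (auto simp: dlists_def)
  have fin: "finite (?f ` dlist_pairs (T - {j}))" "finite (dlists (T - {j}))"
    using finite_dlists[OF assms(1)] eq by (metis finite_Un)+
  show ?thesis
    unfolding eq sum.union_disjoint[OF fin(2,1) disj] sum.reindex[OF inj]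
    by (simp add: o_def case_prod_unfold)
qed

section \<open>Coquaternions and Hermitian families\<close>

lemma coquat_cnj_mult: "coquat_cnj (p * q) = coquat_cnj q * coquat_cnj p"
  by (simp add: coquat_cnj_def coquat_ops_defs algebra_simps)

lemma coquat_cnj_add: "coquat_cnj (p + q) = coquat_cnj p + coquat_cnj q"
  by (simp add: coquat_cnj_def coquat_ops_defs)

lemma coquat_cnj_minus: "coquat_cnj (- p) = - coquat_cnj p"
  by (simp add: coquat_cnj_def coquat_ops_defs)

lemma coquat_cnj_cnj [simp]: "coquat_cnj (coquat_cnj p) = p"
  by (simp add: coquat_cnj_def)

lemma coquat_of_real: "of_real r = Coquat r 0 0 0"
  by (simp add: of_real_def coquat_ops_defs)

lemma coquat_cnj_of_real [simp]: "coquat_cnj (of_real r) = of_real r"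
  by (simp add: coquat_of_real coquat_cnj_def)

lemma coquat_cnj_0 [simp]: "coquat_cnj 0 = 0" and coquat_cnj_1 [simp]: "coquat_cnj 1 = 1"
  by (simp_all add: coquat_cnj_def coquat_ops_defs)

lemma coquat_cnj_sum: "coquat_cnj (sum f I) = (\<Sum>x\<in>I. coquat_cnj (f x))"
  by (induction I rule: infinite_finite_induct) (simp_all add: coquat_cnj_add)

lemma coquat_cnj_sign [simp]: "coquat_cnj ((- 1) ^ k) = (- 1) ^ k"
  by (cases "even k") (simp_all add: coquat_cnj_minus)

lemma coquat_real_iff: "q \<in> \<real> \<longleftrightarrow> coquat_cnj q = q"
proof
  assume "coquat_cnj q = q"
  then have "q = of_real (Cq0 q)"
    by (simp add: coquat_of_real coquat_cnj_def coquat_eq_iff)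
  then show "q \<in> \<real>" by (metis Reals_of_real)
qed (auto elim: Reals_cases)

lemma coquat_real_commute: "r \<in> \<real> \<Longrightarrow> r * (q :: coquat) = q * r"
  by (auto elim!: Reals_cases simp: of_real_def)

text \<open>The real part behaves like a trace: under it a closed walk may be rotated although the
  entries do not commute.\<close>

lemma Cq0_mult_commute: "Cq0 (p * q) = Cq0 (q * p)"
  by (simp add: times_coquat_def algebra_simps)

lemma Cq0_sum: "Cq0 (sum f I) = (\<Sum>x\<in>I. Cq0 (f x))"
  by (induction I rule: infinite_finite_induct) (simp_all add: coquat_ops_defs)

lemma Cq0_mult_real: "r \<in> \<real> \<Longrightarrow> Cq0 (q * r) = Cq0 q * Cq0 r"
  by (auto elim!: Reals_cases simp: coquat_of_real times_coquat_def)

lemma Cq0_sign_mult: "Cq0 ((- 1) ^ k * q) = (- 1) ^ k * Cq0 q"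
  by (cases "even k") (simp_all, simp add: uminus_coquat_def)

lemma coquat_real_eq_iff: "p \<in> \<real> \<Longrightarrow> q \<in> \<real> \<Longrightarrow> p = q \<longleftrightarrow> Cq0 p = Cq0 q"
  by (auto elim!: Reals_cases simp: coquat_of_real)

lemma card_Diff_cycle_less:
  assumes "finite S" "i \<in> S" shows "card (S - set (i # xs)) < card S"
  using assms by (intro psubset_card_mono) (simp_all, blast)

section \<open>Real values and independence of the row\<close>

text \<open>The symmetry is demanded on \<open>U\<close>, because a matrix has meaningful entries
  only within its dimensions.\<close>

locale hermitian_entries =
  fixes a :: "nat \<times> nat \<Rightarrow> coquat" and U :: "nat set"
  assumes herm: "\<And>s t. s \<in> U \<Longrightarrow> t \<in> U \<Longrightarrow> a (s, t) = coquat_cnj (a (t, s))"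
begin

text \<open>Conjugation reverses the product and exchanges the two indices of each entry, so the
  walk is traversed backwards.\<close>

lemma path_prod_reverse:
  assumes "x \<in> U" "z \<in> U" "set ys \<subseteq> U"
  shows "path_prod a z (rev ys) x = coquat_cnj (path_prod a x ys z)"
  using assms
proof (induction ys arbitrary: x)
  case Nil
  then show ?case using herm[of z x] by simp
next
  case (Cons y ys)
  then show ?case
    using herm[of y x] by (simp add: path_prod_append coquat_cnj_mult)
qed

text \<open>Conjugation turns \<open>xs\<close> into \<open>rev xs\<close>, an involution of the
  summation range that preserves the sign and the complementary determinant; the latter is real and
  so commutes with the walk.\<close>

lemma row_expansion_real_step:
  assumes S: "finite S" "S \<subseteq> U" "i \<in> S"
    and IH: "\<And>xs. cycles_det a (S - set (i # xs)) \<in> \<real>"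
  shows "row_expansion a S i i \<in> \<real>"
proof -
  let ?D = "\<lambda>xs. cycles_det a (S - set (i # xs))"
  have "coquat_cnj (row_expansion a S i i) =
      (\<Sum>xs\<in>dlists (S - {i}). (- 1) ^ length xs * path_prod a i (rev xs) i * ?D xs)"
    unfolding row_expansion_def coquat_cnj_sum
  proof (rule sum.cong[OF refl])
    fix xs assume "xs \<in> dlists (S - {i})"
    then have "path_prod a i (rev xs) i = coquat_cnj (path_prod a i xs i)"
      using S by (intro path_prod_reverse) (auto simp: dlists_def)
    then show "coquat_cnj ((- 1) ^ length xs * path_prod a i xs i * ?D xs)
        = (- 1) ^ length xs * path_prod a i (rev xs) i * ?D xs"
      using IH[of xs] coquat_real_commute[OF IH[of xs]]
      by (simp add: coquat_cnj_mult coquat_real_iff sign_commute)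
  qed
  also have "\<dots> = row_expansion a S i i"
    unfolding row_expansion_def
    by (rule sum.reindex_bij_witness[where i = rev and j = rev]) (auto simp: dlists_def)
  finally show ?thesis by (simp add: coquat_real_iff)
qed

lemma cycles_det_real:
  assumes "finite S" "S \<subseteq> U"
  shows "cycles_det a S \<in> \<real>"
  using assms
proof (induction "card S" arbitrary: S rule: less_induct)
  case less
  show ?case
  proof (cases "S = {}")
    case False
    then have "Min S \<in> S" using less.prems by simp
    then have "row_expansion a S (Min S) (Min S) \<in> \<real>"
      using less by (intro row_expansion_real_step less.hyps card_Diff_cycle_less) auto
    then show ?thesis unfolding cycles_det_eq_row_expansion[OF less.prems(1) False] .
  qed (simp add: cycles_det_empty)
qed

lemma row_expansion_real:
  assumes "finite S" "S \<subseteq> U" "i \<in> S"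
  shows "row_expansion a S i i \<in> \<real>"
  using assms by (auto intro: row_expansion_real_step cycles_det_real)

text \<open>
  Walks through \<open>i\<close> and \<open>j\<close>: either the cycle of \<open>i\<close> avoids \<open>j\<close>, and then the real determinant of the
  remaining indices may be expanded along \<open>j\<close> and moved to the front, or it is cut at \<open>j\<close>.
\<close>

lemma row_expansion_split:
  assumes S: "finite S" "S \<subseteq> U" "i \<in> S" "j \<in> S" "i \<noteq> j"
    and IH: "\<forall>xs\<in>dlists (S - {i} - {j}).
      cycles_det a (S - set (i # xs)) = row_expansion a (S - set (i # xs)) j j"
  shows "row_expansion a S k i =
    (\<Sum>(xs, ys)\<in>dlist_pairs (S - {i} - {j}). (- 1) ^ (length xs + length ys) *
      path_prod a j ys j * path_prod a k xs i * cycles_det a (S - {i, j} - set xs - set ys))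
    - (\<Sum>(xs, ys)\<in>dlist_pairs (S - {i} - {j}). (- 1) ^ (length xs + length ys) *
      path_prod a k xs j * path_prod a j ys i * cycles_det a (S - {i, j} - set xs - set ys))"
proof -
  let ?T = "S - {i} - {j}"
  have "row_expansion a S k i = (\<Sum>xs\<in>dlists ?T.
      (- 1) ^ length xs * path_prod a k xs i * cycles_det a (S - set (i # xs)))
    + (\<Sum>(xs, ys)\<in>dlist_pairs ?T. (- 1) ^ length (xs @ j # ys) *
      path_prod a k (xs @ j # ys) i * cycles_det a (S - set (i # xs @ j # ys)))"
    unfolding row_expansion_def using S by (intro sum_dlists_split) auto
  also have "(\<Sum>xs\<in>dlists ?T.
      (- 1) ^ length xs * path_prod a k xs i * cycles_det a (S - set (i # xs))) =
    (\<Sum>xs\<in>dlists ?T. \<Sum>ys\<in>dlists (?T - set xs). (- 1) ^ (length xs + length ys) *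
      path_prod a j ys j * path_prod a k xs i * cycles_det a (S - {i, j} - set xs - set ys))"
  proof (rule sum.cong[OF refl])
    fix xs assume xs: "xs \<in> dlists ?T"
    have "S - set (i # xs) - {j} = ?T - set xs" by auto
    moreover have "S - set (i # xs) - set (j # ys) = S - {i, j} - set xs - set ys" for ys by auto
    moreover have "j \<in> S - set (i # xs)" using xs S by (auto simp: dlists_def)
    then have "row_expansion a (S - set (i # xs)) j j \<in> \<real>"
      using S by (intro row_expansion_real) auto
    \<comment> \<open>The expansion along \<open>j\<close> is real as a whole, which allows it to
      pass to the left of the walk from \<open>k\<close> to \<open>i\<close>.\<close>
    ultimately have "path_prod a k xs i * cycles_det a (S - set (i # xs)) =
      (\<Sum>ys\<in>dlists (?T - set xs). (- 1) ^ length ys * path_prod a j ys j *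
        cycles_det a (S - {i, j} - set xs - set ys) * path_prod a k xs i)"
      using coquat_real_commute[of "row_expansion a (S - set (i # xs)) j j" "path_prod a k xs i"]
      unfolding IH[rule_format, OF xs] by (simp only: row_expansion_def sum_distrib_right)
    also have "\<dots> = (\<Sum>ys\<in>dlists (?T - set xs). (- 1) ^ length ys * (path_prod a j ys j *
        (path_prod a k xs i * cycles_det a (S - {i, j} - set xs - set ys))))"
    proof (rule sum.cong[OF refl])
      fix ys
      \<comment> \<open>Each smaller determinant is real too and moves back to the right
        end.\<close>
      have "cycles_det a (S - {i, j} - set xs - set ys) \<in> \<real>"
        using S by (intro cycles_det_real) auto
      then show "(- 1) ^ length ys * path_prod a j ys j *
          cycles_det a (S - {i, j} - set xs - set ys) * path_prod a k xs i =
        (- 1) ^ length ys * (path_prod a j ys j *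
          (path_prod a k xs i * cycles_det a (S - {i, j} - set xs - set ys)))"
        by (simp only: mult.assoc coquat_real_commute)
    qed
    finally have rearrange: "path_prod a k xs i * cycles_det a (S - set (i # xs)) = \<dots>" .
    show "(- 1) ^ length xs * path_prod a k xs i * cycles_det a (S - set (i # xs)) =
      (\<Sum>ys\<in>dlists (?T - set xs). (- 1) ^ (length xs + length ys) *
      path_prod a j ys j * path_prod a k xs i * cycles_det a (S - {i, j} - set xs - set ys))"
      by (simp only: mult.assoc rearrange sum_distrib_left power_add)
  qed
  also have "\<dots> = (\<Sum>(xs, ys)\<in>dlist_pairs ?T. (- 1) ^ (length xs + length ys) *
      path_prod a j ys j * path_prod a k xs i * cycles_det a (S - {i, j} - set xs - set ys))"
    using S by (intro sum_dlists_nested) simp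
  \<comment> \<open>The inserted \<open>j\<close> lengthens the list by one, whence the minus
    sign.\<close>
  also have "(\<Sum>(xs, ys)\<in>dlist_pairs ?T. (- 1) ^ length (xs @ j # ys) *
      path_prod a k (xs @ j # ys) i * cycles_det a (S - set (i # xs @ j # ys))) =
    - (\<Sum>(xs, ys)\<in>dlist_pairs ?T. (- 1) ^ (length xs + length ys) *
      path_prod a k xs j * path_prod a j ys i * cycles_det a (S - {i, j} - set xs - set ys))"
    unfolding sum_negf[symmetric]
  proof (rule sum.cong[OF refl], clarify)
    fix xs ys
    have "S - set (i # xs @ j # ys) = S - {i, j} - set xs - set ys" by auto
    then show "(- 1) ^ length (xs @ j # ys) *
      path_prod a k (xs @ j # ys) i * cycles_det a (S - set (i # xs @ j # ys)) =
      - ((- 1) ^ (length xs + length ys) *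
      path_prod a k xs j * path_prod a j ys i * cycles_det a (S - {i, j} - set xs - set ys))"
      by (simp add: path_prod_append mult.assoc)
  qed
  finally show ?thesis by simp
qed

text \<open>Both sides are real, so their real parts decide. Splitting the first at \<open>j\<close>
  and the second at \<open>i\<close> yields the same two sums, up to interchanging the lists and
  rotating the product of the two walks.\<close>

lemma row_expansion_independent:
  assumes "finite S" "S \<subseteq> U" "i \<in> S" "j \<in> S"
  shows "row_expansion a S i i = row_expansion a S j j"
  using assms
proof (induction "card S" arbitrary: S i j rule: less_induct)
  case less
  show ?case
  proof (cases "i = j")
    case False
    have IH: "\<forall>xs\<in>dlists (S - {i} - {j}).
        cycles_det a (S - set (i # xs)) = row_expansion a (S - set (i # xs)) j j"
      if "i \<in> S" "j \<in> S" "i \<noteq> j" for i j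
    proof
      \<comment> \<open>The complement of the cycle is smaller, so by induction its expansion at the
        minimum may be replaced by the one at \<open>j\<close>.\<close>
      fix xs assume xs: "xs \<in> dlists (S - {i} - {j})"
      let ?S' = "S - set (i # xs)"
      have j: "j \<in> ?S'" using xs that by (auto simp: dlists_def)
      have "finite ?S'" "?S' \<noteq> {}" using less.prems j by auto
      then have "cycles_det a ?S' = row_expansion a ?S' (Min ?S') (Min ?S')" "Min ?S' \<in> ?S'"
        by (rule cycles_det_eq_row_expansion, rule Min_in)
      moreover have "row_expansion a ?S' (Min ?S') (Min ?S') = row_expansion a ?S' j j"
        using less.prems j \<open>Min ?S' \<in> ?S'\<close> \<open>i \<in> S\<close>
        by (intro less.hyps card_Diff_cycle_less) auto
      ultimately show "cycles_det a ?S' = row_expansion a ?S' j j" by simp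
    qed
    let ?P = "\<lambda>i j. dlist_pairs (S - {i} - {j})"
    let ?d = "\<lambda>i j xs ys. Cq0 (cycles_det a (S - {i, j} - set xs - set ys))"
    have d: "cycles_det a (S - {i, j} - set xs - set ys) \<in> \<real>" for i j xs ys
      using less.prems by (intro cycles_det_real) auto
    have split: "Cq0 (row_expansion a S i i) =
      (\<Sum>(xs, ys)\<in>?P i j. (- 1) ^ (length xs + length ys) *
        (Cq0 (path_prod a j ys j * path_prod a i xs i) * ?d i j xs ys))
      - (\<Sum>(xs, ys)\<in>?P i j. (- 1) ^ (length xs + length ys) *
        (Cq0 (path_prod a i xs j * path_prod a j ys i) * ?d i j xs ys))"
      if "i \<in> S" "j \<in> S" "i \<noteq> j" for i j
    proof -
      have summand: "Cq0 ((- 1) ^ (length xs + length ys) * p * q * cycles_det a (S - {i, j} - set xs - set ys))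
          = (- 1) ^ (length xs + length ys) * (Cq0 (p * q) * ?d i j xs ys)" for xs ys p q
        unfolding mult.assoc Cq0_sign_mult unfolding mult.assoc[symmetric] Cq0_mult_real[OF d] ..
      show ?thesis
        unfolding row_expansion_split[OF less.prems(1,2) that IH[OF that], where k = i]
          minus_coquat_def coquat.sel Cq0_sum case_prod_unfold summand ..
    qed
    have swap: "?P j i = ?P i j" "?d j i xs ys = ?d i j ys xs" for xs ys
      by (rule arg_cong[where f = dlist_pairs], blast)
        (rule arg_cong[where f = "\<lambda>S. Cq0 (cycles_det a S)"], blast)
    have "Cq0 (row_expansion a S j j) =
      (\<Sum>(ys, xs)\<in>?P i j. (- 1) ^ (length ys + length xs) *
        (Cq0 (path_prod a i xs i * path_prod a j ys j) * ?d i j xs ys))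
      - (\<Sum>(ys, xs)\<in>?P i j. (- 1) ^ (length ys + length xs) *
        (Cq0 (path_prod a j ys i * path_prod a i xs j) * ?d i j xs ys))"
      unfolding split[OF less.prems(4,3) False[symmetric]] swap ..
    also have "\<dots> = Cq0 (row_expansion a S i i)"
      unfolding split[OF less.prems(3,4) False]
      by (subst (1 2) sum_dlist_pairs_swap)
        (intro arg_cong2[where f = minus] sum.cong refl; clarsimp simp: add.commute; metis Cq0_mult_commute)
    finally have "Cq0 (row_expansion a S i i) = Cq0 (row_expansion a S j j)" ..
    then show ?thesis
      using less.prems by (simp add: coquat_real_eq_iff row_expansion_real)
  qed simp
qed

lemma cycles_det_eq_row_expansion_any:
  assumes "finite S" "S \<subseteq> U" "i \<in> S"
  shows "cycles_det a S = row_expansion a S i i"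
proof -
  have "S \<noteq> {}" using assms by auto
  then show ?thesis
    using assms by (simp add: cycles_det_eq_row_expansion row_expansion_independent[of S "Min S" i])
qed

text \<open>This is the vanishing of a determinant with two equal rows: splitting at
  \<open>k\<close> gives two sums that interchanging the lists carries into each other.\<close>

lemma row_expansion_eq_0:
  assumes S: "finite S" "S \<subseteq> U" "i \<in> S" "k \<in> S" "i \<noteq> k"
  shows "row_expansion a S k i = 0"
proof -
  have "\<forall>xs\<in>dlists (S - {i} - {k}).
      cycles_det a (S - set (i # xs)) = row_expansion a (S - set (i # xs)) k k"
    using S by (intro ballI cycles_det_eq_row_expansion_any) (auto simp: dlists_def)
  note split = row_expansion_split[OF S this, where k = k]
  have swap: "S - {i, k} - set xs - set ys = S - {i, k} - set ys - set xs" for xs ys by auto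
  show ?thesis
    unfolding split right_minus_eq
    by (subst sum_dlist_pairs_swap, subst swap) (simp only: add.commute)
qed

end

section \<open>Cofactors as determinants of smaller matrices\<close>

text \<open>The endpoints \<open>z\<close> and \<open>z'\<close> may differ, so that a step into a
  replaced column can be compared with a step into the original one.\<close>

lemma path_prod_cong:
  assumes "\<And>s t. s \<in> insert x (set ys) \<Longrightarrow> t \<in> set ys \<Longrightarrow> a (s, t) = b (s, t)"
    and "\<And>s. s \<in> insert x (set ys) \<Longrightarrow> a (s, z) = b (s, z')"
  shows "path_prod a x ys z = path_prod b x ys z'"
  using assms by (induction ys arbitrary: x) simp_all

lemma row_expansion_cong_step:
  assumes S: "S \<subseteq> U" "k \<in> U" "i \<in> S"
    and ab: "\<And>s t. s \<in> U \<Longrightarrow> t \<in> U \<Longrightarrow> a (s, t) = b (s, t)"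
    and IH: "\<And>xs. cycles_det a (S - set (i # xs)) = cycles_det b (S - set (i # xs))"
  shows "row_expansion a S k i = row_expansion b S k i"
proof -
  have "path_prod a k xs i = path_prod b k xs i" if "xs \<in> dlists (S - {i})" for xs
    using that S by (intro path_prod_cong ab) (auto simp: dlists_def)
  then show ?thesis
    unfolding row_expansion_def IH by (intro sum.cong refl) simp
qed

lemma cycles_det_cong:
  assumes "finite S" "\<And>s t. s \<in> S \<Longrightarrow> t \<in> S \<Longrightarrow> a (s, t) = b (s, t)"
  shows "cycles_det a S = cycles_det b S"
  using assms
proof (induction "card S" arbitrary: S rule: less_induct)
  case less
  show ?case
  proof (cases "S = {}")
    case False
    then have Min: "Min S \<in> S" using less.prems by simp
    have "row_expansion a S (Min S) (Min S) = row_expansion b S (Min S) (Min S)"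
      using less.prems
      by (intro row_expansion_cong_step[where U = S] less.hyps card_Diff_cycle_less Min) auto
    then show ?thesis unfolding cycles_det_eq_row_expansion[OF less.prems(1) False] .
  qed (simp add: cycles_det_empty)
qed

lemma row_expansion_cong:
  assumes "finite S" "i \<in> S" "k \<in> S" "\<And>s t. s \<in> S \<Longrightarrow> t \<in> S \<Longrightarrow> a (s, t) = b (s, t)"
  shows "row_expansion a S k i = row_expansion b S k i"
  using assms by (intro row_expansion_cong_step[where U = S] cycles_det_cong) auto

lemma path_prod_relabel:
  "path_prod (a \<circ> map_prod f f) x ys z = path_prod a (f x) (map f ys) (f z)"
  by (induction ys arbitrary: x) simp_all

lemma dlists_image:
  assumes "inj f" shows "dlists (f ` T) = map f ` dlists T"
proof (intro equalityI subsetI)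
  fix xs assume xs: "xs \<in> dlists (f ` T)"
  then have "xs \<in> lists (f ` T)" by (auto simp: dlists_def)
  then obtain ys where "ys \<in> lists T" "xs = map f ys" unfolding lists_image by auto
  then show "xs \<in> map f ` dlists T" using xs by (auto simp: dlists_def distinct_map)
qed (use assms in \<open>auto simp: dlists_def distinct_map inj_on_subset[OF assms] subset_iff\<close>)

lemma row_expansion_relabel_step:
  assumes f: "inj f"
    and IH: "\<And>xs. cycles_det (a \<circ> map_prod f f) (S - set (i # xs)) = cycles_det a (f ` (S - set (i # xs)))"
  shows "row_expansion (a \<circ> map_prod f f) S k i = row_expansion a (f ` S) (f k) (f i)"
proof -
  have "f ` S - {f i} = f ` (S - {i})"
    and "f ` S - set (f i # map f xs) = f ` (S - set (i # xs))" for xs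
    using image_set_diff[OF f, of S "{i}"] image_set_diff[OF f, of S "set (i # xs)"] by simp_all
  moreover have "inj_on (map f) X" for X using f by (simp add: inj_on_subset[of _ UNIV])
  ultimately show ?thesis
    unfolding row_expansion_def
    by (simp only: dlists_image[OF f] sum.reindex o_def[of _ "map f"] length_map)
      (simp only: IH path_prod_relabel)
qed

text \<open>A strictly monotone \<open>f\<close> carries minima to minima, so corresponding cycles
  are opened at corresponding points.\<close>

lemma cycles_det_relabel:
  assumes f: "strict_mono f" and "finite S"
  shows "cycles_det (a \<circ> map_prod f f) S = cycles_det a (f ` S)"
  using assms(2)
proof (induction "card S" arbitrary: S rule: less_induct)
  case less
  have inj: "inj f" by (rule strict_mono_imp_inj_on[OF f])
  show ?case
  proof (cases "S = {}")
    case False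
    then have Min: "Min S \<in> S" using less.prems by simp
    have "Min (f ` S) = f (Min S)"
      using mono_Min_commute[OF strict_mono_mono[OF f] less.prems False] by simp
    moreover have "row_expansion (a \<circ> map_prod f f) S (Min S) (Min S) = row_expansion a (f ` S) (f (Min S)) (f (Min S))"
      using less.prems by (intro row_expansion_relabel_step[OF inj] less.hyps card_Diff_cycle_less Min) auto
    ultimately show ?thesis
      using False less.prems by (simp add: cycles_det_eq_row_expansion)
  qed (simp add: cycles_det_empty)
qed

lemma row_expansion_relabel:
  assumes "strict_mono f" and "finite S"
  shows "row_expansion (a \<circ> map_prod f f) S k i = row_expansion a (f ` S) (f k) (f i)"
  using assms
  by (intro row_expansion_relabel_step strict_mono_imp_inj_on cycles_det_relabel) auto

text \<open>The map \<open>insert_index i\<close> enumerates the indices other than \<open>i\<close>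
  in increasing order, and \<open>delete_pos i j\<close> is the position of \<open>j\<close> in this
  enumeration.\<close>

lemma rdet_mat_delete:
  assumes B: "B \<in> carrier_mat n n" and ij: "i < n" "j < n" "i \<noteq> j"
  shows "rdet (delete_pos i j) (mat_delete B i i) = row_expansion (($$) B) ({0..<n} - {i}) j j"
proof -
  obtain m where n: "n = Suc m" using ij by (cases n) auto
  let ?f = "insert_index i"
  have f: "strict_mono ?f" by (auto simp: strict_mono_def insert_index_def)
  have k: "delete_pos i j < m" "?f (delete_pos i j) = j"
    using ij n by (auto simp: delete_pos_def insert_index_def)
  have "rdet (delete_pos i j) (mat_delete B i i) =
      row_expansion (($$) (mat_delete B i i)) {0..<m} (delete_pos i j) (delete_pos i j)"
    using B n k by (intro rdet_eq_row_expansion) auto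
  also have "\<dots> = row_expansion (($$) B \<circ> map_prod ?f ?f) {0..<m} (delete_pos i j) (delete_pos i j)"
    using k ij(1) mat_delete_index[OF B[unfolded n], of i i] unfolding n by (intro row_expansion_cong) auto
  also have "\<dots> = row_expansion (($$) B) (?f ` {0..<m}) j j"
    by (simp add: row_expansion_relabel[OF f] k)
  also have "?f ` {0..<m} = {0..<n} - {i}"
  proof (intro equalityI subsetI)
    fix s assume s: "s \<in> {0..<n} - {i}"
    then have "delete_index i s < m" using ij n by (auto simp: delete_index_def)
    then show "s \<in> ?f ` {0..<m}" using s insert_delete_index[of s i] by force
  qed (auto simp: insert_index_def n)
  finally show ?thesis .
qed

lemma Min_deleted_interval:
  fixes n i :: nat
  assumes "n \<ge> 2" "i < n" shows "Min ({0..<n} - {i}) \<in> {0..<n} - {i}"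
proof (rule Min_in)
  have "card ({0..<n} - {i}) > 0" using assms by simp
  then show "{0..<n} - {i} \<noteq> {}" by (metis card.empty less_irrefl)
qed simp

text \<open>The cofactor is \<open>cycles_det\<close> on the remaining indices, whose words begin
  with the cycle of the least of them; this explains the choice of row.\<close>

lemma right_cofactor_diag_rdet:
  assumes A: "A \<in> carrier_mat n n" and "n \<ge> 2" "i < n"
  shows "right_cofactor A i i = rdet (delete_pos i (Min ({0..<n} - {i}))) (mat_delete A i i)"
proof -
  let ?T = "{0..<n} - {i}"
  note Min_deleted_interval[OF assms(2,3)]
  moreover from this have T: "?T \<noteq> {}" by blast
  ultimately have "Min ?T < n" "i \<noteq> Min ?T" by auto
  then show ?thesis
    using assms T by (simp add: rdet_mat_delete right_cofactor_diag cycles_det_eq_row_expansion)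
qed

text \<open>Column \<open>j\<close> is read only by the last step of the cycle through
  \<open>j\<close>. After the replacement this step ends in column \<open>i\<close> of
  \<open>A\<close>, as in the cofactor.\<close>

lemma right_cofactor_off_diag_rdet:
  assumes A: "A \<in> carrier_mat n n" and ij: "i < n" "j < n" "i \<noteq> j"
  shows "right_cofactor A i j = - rdet (delete_pos i j) (mat_delete (replace_col A (col A i) j) i i)"
proof -
  let ?B = "replace_col A (col A i) j" and ?T = "{0..<n} - {i}"
  have B: "?B \<in> carrier_mat n n" using A by (auto simp: replace_col_def)
  have B_index: "?B $$ (s, t) = A $$ (s, if t = j then i else t)" if "s < n" "t < n" for s t
    using A ij that by (auto simp: replace_col_def)
  have "path_prod (($$) ?B) j ys j = path_prod (($$) A) j ys i"
    and "cycles_det (($$) ?B) (?T - set (j # ys)) = cycles_det (($$) A) (?T - set (j # ys))"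
    if "ys \<in> dlists (?T - {j})" for ys
  proof -
    have ys: "s < n" "s \<noteq> j" if "s \<in> set ys" for s
      using that \<open>ys \<in> _\<close> by (auto simp: dlists_def)
    show "path_prod (($$) ?B) j ys j = path_prod (($$) A) j ys i"
      using ij by (intro path_prod_cong) (auto simp: B_index ys)
    show "cycles_det (($$) ?B) (?T - set (j # ys)) = cycles_det (($$) A) (?T - set (j # ys))"
      using ij by (intro cycles_det_cong) (auto simp: B_index)
  qed
  then show ?thesis
    using A ij unfolding rdet_mat_delete[OF B ij]
    by (subst right_cofactor_off_diag) (auto simp: row_expansion_def intro!: sum.cong)
qed

section \<open>Column determinants by conjugation\<close>

text \<open>The prefix \<open>inv\<close> is taken by the group inverse of HOL-Algebra.\<close>

abbreviation fun_inv :: "('a \<Rightarrow> 'b) \<Rightarrow> 'b \<Rightarrow> 'a" where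
  "fun_inv \<equiv> inv_into UNIV"

lemma least_power_inv:
  assumes "bij \<sigma>" shows "least_power (fun_inv \<sigma>) s = least_power \<sigma> s"
proof -
  have "(fun_inv \<sigma> ^^ n) s = s \<longleftrightarrow> (\<sigma> ^^ n) s = s" for n
    using bij_inv_eq_iff[OF bij_fn[OF assms]] inv_fn[OF assms, of n] by metis
  then show ?thesis by (simp add: least_power_def)
qed

text \<open>The inverse runs through the same cycle backwards from \<open>s\<close>, so the factors
  appear in reverse order with their indices exchanged.\<close>

lemma cycle_word_inv:
  assumes "permutation \<sigma>"
  shows "cycle_word (fun_inv \<sigma>) s = map prod.swap (rev (cycle_word \<sigma> s))"
proof -
  have bij: "bij \<sigma>" using assms by (simp add: permutation_bijective)
  let ?L = "least_power \<sigma> s"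
  \<comment> \<open>As \<open>?L\<close> steps of \<open>\<sigma>\<close> return to
    \<open>s\<close>, going back \<open>k\<close> steps equals going forward \<open>?L - k\<close>
    steps.\<close>
  have pow: "(fun_inv \<sigma> ^^ k) s = (\<sigma> ^^ (?L - k)) s" if "k \<le> ?L" for k
  proof -
    have "(\<sigma> ^^ k) ((\<sigma> ^^ (?L - k)) s) = s"
      using least_power_of_permutation(1)[OF assms, of s] that
      by (metis funpow_add le_add_diff_inverse o_apply)
    then show ?thesis
      using bij_inv_eq_iff[OF bij_fn[OF bij, of k]] inv_fn[OF bij, of k] by metis
  qed
  show ?thesis
  proof (rule nth_equalityI)
    fix k assume "k < length (cycle_word (fun_inv \<sigma>) s)"
    then have k: "k < ?L" by (simp add: cycle_word_def least_power_inv[OF bij])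
    have "fun_inv \<sigma> ((fun_inv \<sigma> ^^ k) s) = (\<sigma> ^^ (?L - Suc k)) s"
      using pow[of "Suc k"] k by simp
    moreover have "\<sigma> ((\<sigma> ^^ (?L - Suc k)) s) = (\<sigma> ^^ (?L - k)) s"
      using k by (metis Suc_diff_Suc funpow.simps(2) o_apply)
    ultimately show "cycle_word (fun_inv \<sigma>) s ! k = map prod.swap (rev (cycle_word \<sigma> s)) ! k"
      using k pow[of k] by (simp add: cycle_word_def least_power_inv[OF bij] rev_nth)
  qed (simp add: cycle_word_def least_power_inv[OF bij])
qed

text \<open>The first and the second components of a cycle word range over the same set, so
  reversing and swapping leaves the cycle unchanged as a set.\<close>

lemma cycle_sets_inv:
  assumes "permutation \<sigma>" shows "cycle_sets n (fun_inv \<sigma>) = cycle_sets n \<sigma>"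
proof -
  have "set (support \<sigma> s) = fst ` set (cycle_word \<sigma> s)" for \<sigma> :: "nat \<Rightarrow> nat" and s
    by (simp add: cycle_word_def image_image)
  moreover have "snd ` set (cycle_word \<sigma> s) = set (support \<sigma> s)" for s
  proof -
    have "set (map \<sigma> (support \<sigma> s)) = set (map (cycle_of_list (support \<sigma> s)) (support \<sigma> s))"
      using cycle_restrict[OF assms, of _ s] by (metis map_cong)
    also have "\<dots> = set (support \<sigma> s)"
      unfolding set_map[of "cycle_of_list _"] by (rule cycle_is_surj[OF cycle_of_permutation[OF assms]])
    finally show ?thesis by (simp add: cycle_word_def image_image)
  qed
  ultimately have "set (support (fun_inv \<sigma>) s) = set (support \<sigma> s)" for s
    by (simp only: cycle_word_inv[OF assms] set_map set_rev image_image fst_swap)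
  then show ?thesis unfolding cycle_sets_def by simp
qed

text \<open>Inversion reverses each cycle word and keeps the starting points; column determinants
  take the cycles in the opposite order, so the whole word is reversed.\<close>

lemma cdet_word_inv:
  assumes "permutation \<sigma>"
  shows "cdet_word n i (fun_inv \<sigma>) = map prod.swap (rev (rdet_word n i \<sigma>))"
proof -
  have "cycle_word (fun_inv \<sigma>) = (\<lambda>s. map prod.swap (rev (cycle_word \<sigma> s)))"
    using cycle_word_inv[OF assms] by blast
  then show ?thesis
    by (simp add: cdet_word_def rdet_word_def cycle_starts_def cycle_sets_inv[OF assms]
        rev_concat map_concat rev_map o_def)
qed

lemma rdet_word_nonempty: "permutation \<sigma> \<Longrightarrow> rdet_word n i \<sigma> \<noteq> []"
  using least_power_of_permutation(2)[of \<sigma> i] by (simp add: rdet_word_def cycle_starts_def cycle_word_def)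

lemma set_rdet_word:
  assumes \<sigma>: "\<sigma> permutes {0..<n}" and i: "i < n"
  shows "set (rdet_word n i \<sigma>) \<subseteq> {0..<n} \<times> {0..<n}"
proof -
  have perm: "permutation \<sigma>" using \<sigma> permutation_permutes by blast
  have pow: "(\<sigma> ^^ k) s < n" if "s < n" for k s
    using permutes_in_image[OF permutes_funpow[OF \<sigma>, of k], of s] that by simp
  have cyc: "C \<noteq> {}" "C \<subseteq> {0..<n}" if "C \<in> cycle_sets n \<sigma>" for C
    using that pow least_power_of_permutation(2)[OF perm] by (auto simp: cycle_sets_def)
  have "Min C < n" if "C \<in> cycle_sets n \<sigma>" for C
    using Min_in[of C] cyc[OF that] by (meson atLeastLessThan_iff finite_atLeastLessThan finite_subset subsetD)
  moreover have "finite (cycle_sets n \<sigma>)" by (simp add: cycle_sets_def)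
  ultimately have "s < n" if "s \<in> set (cycle_starts n i \<sigma>)" for s
    using that i by (auto simp: cycle_starts_def)
  then show ?thesis
    using pow pow[where k = "Suc _"] by (fastforce simp: rdet_word_def cycle_word_def)
qed

lemma coquat_cnj_word_prod:
  assumes A: "A \<in> carrier_mat n n" and "set w \<subseteq> {0..<n} \<times> {0..<n}"
  shows "coquat_cnj (word_prod (coquat_adjoint A) w) = word_prod A (map prod.swap (rev w))"
  using assms(2)
proof (induction w)
  case (Cons p w)
  then have "coquat_adjoint A $$ p = coquat_cnj (A $$ prod.swap p)"
    using A by (cases p) (auto simp: coquat_adjoint_def)
  then show ?case using Cons by (simp add: word_prod_def coquat_cnj_mult)
qed (simp add: word_prod_def)

text \<open>Reindexing by the inverse permutation keeps the sign and reverses and transposes the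
  word, just as conjugating a product of entries of the adjoint does.\<close>

lemma cdet_eq_cnj_rdet:
  assumes A: "A \<in> carrier_mat n n" and i: "i < n"
  shows "cdet i A = coquat_cnj (rdet i (coquat_adjoint A))"
proof -
  have dim: "dim_row A = n" "dim_row (coquat_adjoint A) = n"
    using A by (auto simp: coquat_adjoint_def)
  have "cdet i A = (\<Sum>\<sigma> | \<sigma> permutes {0..<n}. cycle_sign n (fun_inv \<sigma>) * word_prod A (cdet_word n i (fun_inv \<sigma>)))"
    unfolding cdet_def dim Let_def by (rule sum_permutations_inverse)
  also have "\<dots> = (\<Sum>\<sigma> | \<sigma> permutes {0..<n}.
      coquat_cnj (cycle_sign n \<sigma> * word_prod (coquat_adjoint A) (rdet_word n i \<sigma>)))"
  proof (rule sum.cong[OF refl], clarify)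
    fix \<sigma> assume \<sigma>: "\<sigma> permutes {0..<n}"
    then have "permutation \<sigma>" using permutation_permutes by blast
    then show "cycle_sign n (fun_inv \<sigma>) * word_prod A (cdet_word n i (fun_inv \<sigma>)) =
      coquat_cnj (cycle_sign n \<sigma> * word_prod (coquat_adjoint A) (rdet_word n i \<sigma>))"
      by (simp add: cycle_sign_def cycle_sets_inv cdet_word_inv coquat_cnj_mult sign_commute
          coquat_cnj_word_prod[OF A set_rdet_word[OF \<sigma> i]])
  qed
  also have "\<dots> = coquat_cnj (rdet i (coquat_adjoint A))"
    by (simp add: rdet_def dim coquat_cnj_sum)
  finally show ?thesis .
qed

text \<open>The same reindexing turns the deleted leading factor at \<open>(j, i)\<close> into the
  deleted final factor at \<open>(i, j)\<close>.\<close>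

lemma left_cofactor_eq_cnj_right_cofactor:
  assumes A: "A \<in> carrier_mat n n" and j: "j < n"
  shows "left_cofactor A i j = coquat_cnj (right_cofactor (coquat_adjoint A) j i)"
proof -
  have dim: "dim_row A = n" "dim_row (coquat_adjoint A) = n"
    using A by (auto simp: coquat_adjoint_def)
  have last: "last (cdet_word n j (fun_inv \<sigma>)) = prod.swap (hd (rdet_word n j \<sigma>))"
    and term_eq: "cycle_sign n (fun_inv \<sigma>) * word_prod A (butlast (cdet_word n j (fun_inv \<sigma>))) =
      coquat_cnj (cycle_sign n \<sigma> * word_prod (coquat_adjoint A) (tl (rdet_word n j \<sigma>)))"
    if \<sigma>: "\<sigma> permutes {0..<n}" for \<sigma>
  proof -
    have p: "permutation \<sigma>" using \<sigma> permutation_permutes by blast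
    show "last (cdet_word n j (fun_inv \<sigma>)) = prod.swap (hd (rdet_word n j \<sigma>))"
      using rdet_word_nonempty[OF p] by (simp add: cdet_word_inv[OF p] last_map last_rev)
    have "set (tl (rdet_word n j \<sigma>)) \<subseteq> {0..<n} \<times> {0..<n}"
      using set_rdet_word[OF \<sigma> j] rdet_word_nonempty[OF p] by (meson list.set_sel(2) subset_iff)
    then show "cycle_sign n (fun_inv \<sigma>) * word_prod A (butlast (cdet_word n j (fun_inv \<sigma>))) =
      coquat_cnj (cycle_sign n \<sigma> * word_prod (coquat_adjoint A) (tl (rdet_word n j \<sigma>)))"
      by (simp add: cycle_sign_def cycle_sets_inv[OF p] cdet_word_inv[OF p] coquat_cnj_mult sign_commute
          coquat_cnj_word_prod[OF A] flip: map_butlast)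
  qed
  have "coquat_cnj (right_cofactor (coquat_adjoint A) j i) =
      (\<Sum>\<sigma> | \<sigma> permutes {0..<n} \<and> hd (rdet_word n j \<sigma>) = (j, i).
        cycle_sign n (fun_inv \<sigma>) * word_prod A (butlast (cdet_word n j (fun_inv \<sigma>))))"
    unfolding right_cofactor_def dim Let_def coquat_cnj_sum by (intro sum.cong refl) (simp add: term_eq)
  also have "\<dots> = left_cofactor A i j"
    unfolding left_cofactor_def dim Let_def
  proof (rule sum.reindex_bij_witness[where i = fun_inv and j = fun_inv]; clarify?)
    fix \<sigma> assume \<sigma>: "\<sigma> permutes {0..<n}"
    show inv: "fun_inv (fun_inv \<sigma>) = \<sigma>" by (rule permutes_inv_inv[OF \<sigma>])
    show "fun_inv (fun_inv \<sigma>) = \<sigma>" by (rule permutes_inv_inv[OF \<sigma>])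
    { assume "hd (rdet_word n j \<sigma>) = (j, i)"
      then show "fun_inv \<sigma> permutes {0..<n} \<and> last (cdet_word n j (fun_inv \<sigma>)) = (i, j)"
        using permutes_inv[OF \<sigma>] last[OF \<sigma>] by simp }
    { assume "last (cdet_word n j \<sigma>) = (i, j)"
      then have "prod.swap (hd (rdet_word n j (fun_inv \<sigma>))) = (i, j)"
        using last[OF permutes_inv[OF \<sigma>]] inv by simp
      then show "fun_inv \<sigma> permutes {0..<n} \<and> hd (rdet_word n j (fun_inv \<sigma>)) = (j, i)"
        using permutes_inv[OF \<sigma>] by (cases "hd (rdet_word n j (fun_inv \<sigma>))") simp }
  qed
  finally show ?thesis by simp
qed

lemma coquat_adjoint_mat_delete_replace_row:
  assumes A: "A \<in> carrier_mat n n" and ij: "i < n" "j < n"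
  shows "coquat_adjoint (mat_delete (replace_row A (row A j) i) j j)
    = mat_delete (replace_col (coquat_adjoint A) (col (coquat_adjoint A) j) i) j j"
  using A ij
  by (intro eq_matI) (auto simp: coquat_adjoint_def mat_delete_def replace_row_def replace_col_def)

lemma coquat_adjoint_mat_delete:
  assumes "A \<in> carrier_mat n n" "i < n"
  shows "coquat_adjoint (mat_delete A i i) = mat_delete (coquat_adjoint A) i i"
  using assms by (intro eq_matI) (auto simp: coquat_adjoint_def mat_delete_def)

lemma coquat_adjoint_carrier: "A \<in> carrier_mat n n \<Longrightarrow> coquat_adjoint A \<in> carrier_mat n n"
  by (simp add: coquat_adjoint_def)

lemma left_cofactor_off_diag_cdet:
  fixes A :: "coquat mat"
  assumes A: "A \<in> carrier_mat n n" and ij: "i < n" "j < n" "i \<noteq> j"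
  shows "left_cofactor A i j = - cdet (delete_pos j i) (mat_delete (replace_row A (row A j) i) j j)"
proof -
  have "mat_delete (replace_row A (row A j) i) j j \<in> carrier_mat (n - 1) (n - 1)"
    using A by (intro mat_delete_carrier) (auto simp: replace_row_def)
  moreover have "delete_pos j i < n - 1" using ij by (auto simp: delete_pos_def)
  ultimately show ?thesis
    using ij right_cofactor_off_diag_rdet[OF coquat_adjoint_carrier[OF A], of j i]
    by (simp add: left_cofactor_eq_cnj_right_cofactor[OF A] cdet_eq_cnj_rdet coquat_cnj_minus
        coquat_adjoint_mat_delete_replace_row[OF A])
qed

lemma left_cofactor_diag_cdet:
  fixes A :: "coquat mat"
  assumes A: "A \<in> carrier_mat n n" and n: "n \<ge> 2" and i: "i < n"
  shows "left_cofactor A i i = cdet (delete_pos i (Min ({0..<n} - {i}))) (mat_delete A i i)"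
proof -
  have "delete_pos i (Min ({0..<n} - {i})) < n - 1"
    using Min_deleted_interval[OF n i] i by (auto simp: delete_pos_def)
  then show ?thesis
    using right_cofactor_diag_rdet[OF coquat_adjoint_carrier[OF A] n i]
    by (simp add: left_cofactor_eq_cnj_right_cofactor[OF A i] coquat_adjoint_mat_delete[OF A i]
        cdet_eq_cnj_rdet[OF mat_delete_carrier[OF A]])
qed

section \<open>The inverse of a Hermitian matrix\<close>

locale hermitian_coquat_mat =
  fixes A :: "coquat mat" and n :: nat
  assumes n: "n \<ge> 1" and A: "A \<in> carrier_mat n n" and hermitian: "coquat_hermitian A"
begin

sublocale hermitian_entries "($$) A" "{0..<n}"
proof
  fix s t assume "s \<in> {0..<n}" "t \<in> {0..<n}"
  then have "coquat_adjoint A $$ (s, t) = coquat_cnj (A $$ (t, s))"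
    using A by (simp add: coquat_adjoint_def)
  then show "A $$ (s, t) = coquat_cnj (A $$ (t, s))"
    using hermitian by (simp add: coquat_hermitian_def)
qed

text \<open>Row determinants share one real value, and column determinants are their conjugates
  because \<open>A\<close> is its own adjoint. This justifies the definite description in
  \<open>hermitian_det\<close>.\<close>

lemma rdet_cdet_eq_hermitian_det:
  assumes "i < n"
  shows "rdet i A = of_real (hermitian_det A)" "cdet i A = of_real (hermitian_det A)"
proof -
  have dim: "dim_row A = n" using A by simp
  have rdet: "rdet i A = row_expansion (($$) A) {0..<n} i i" if "i < n" for i
    using rdet_eq_row_expansion[OF dim that] .
  have "rdet 0 A \<in> \<real>"
    using row_expansion_real[of "{0..<n}" 0] n rdet[of 0] by simp
  then obtain d where d: "rdet 0 A = of_real d" by (auto elim: Reals_cases)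
  have r: "rdet i A = of_real d" if "i < n" for i
    using row_expansion_independent[of "{0..<n}" i 0] n rdet[of 0] rdet[OF that] d that by simp
  have c: "cdet i A = of_real d" if "i < n" for i
    using cdet_eq_cnj_rdet[OF A that] hermitian r[OF that] by (simp add: coquat_hermitian_def)
  have "hermitian_det A = d"
    unfolding hermitian_det_def dim
  proof (rule the_equality)
    \<comment> \<open>Since \<open>n \<ge> 1\<close>, the index 0 is available to determine
      \<open>d'\<close>.\<close>
    fix d' assume "\<forall>i<n. rdet i A = of_real d' \<and> cdet i A = of_real d'"
    then show "d' = d" using n d by simp
  qed (simp add: r c)
  then show "rdet i A = of_real (hermitian_det A)" "cdet i A = of_real (hermitian_det A)"
    using r c assms by simp_all
qed

lemma sum_row_right_cofactor:
  assumes "i < n" "k < n"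
  shows "(\<Sum>j<n. A $$ (k, j) * right_cofactor A i j) = (if k = i then of_real (hermitian_det A) else 0)"
proof -
  have dim: "dim_row A = n" using A by simp
  show ?thesis
    using rdet_eq_row_expansion[OF dim assms(1)] rdet_cdet_eq_hermitian_det(1)[OF assms(1)] assms
      row_expansion_eq_0[of "{0..<n}" i k]
    by (simp add: sum_right_cofactor[OF dim])
qed

text \<open>For Hermitian \<open>A\<close> this is the conjugate, term by term, of the identity for
  rows and right cofactors.\<close>

lemma sum_left_cofactor_col:
  assumes "i < n" "k < n"
  shows "(\<Sum>j<n. left_cofactor A j i * A $$ (j, k)) = (if k = i then of_real (hermitian_det A) else 0)"
proof -
  have "left_cofactor A j i * A $$ (j, k) = coquat_cnj (A $$ (k, j) * right_cofactor A i j)"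
    if "j < n" for j
    using left_cofactor_eq_cnj_right_cofactor[OF A assms(1), of j] herm[of j k] that assms hermitian
    by (simp add: coquat_hermitian_def coquat_cnj_mult)
  then have "(\<Sum>j<n. left_cofactor A j i * A $$ (j, k)) =
      coquat_cnj (\<Sum>j<n. A $$ (k, j) * right_cofactor A i j)"
    unfolding coquat_cnj_sum by (intro sum.cong) auto
  then show ?thesis by (simp add: sum_row_right_cofactor[OF assms])
qed

definition right_inv :: "coquat mat" where
  "right_inv = of_real (1 / hermitian_det A) \<cdot>\<^sub>m mat n n (\<lambda>(i, j). right_cofactor A j i)"

definition left_inv :: "coquat mat" where
  "left_inv = of_real (1 / hermitian_det A) \<cdot>\<^sub>m mat n n (\<lambda>(i, j). left_cofactor A j i)"

lemma inv_carrier: "right_inv \<in> carrier_mat n n" "left_inv \<in> carrier_mat n n"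
  by (simp_all add: right_inv_def left_inv_def)

lemma mult_right_inv:
  assumes "hermitian_det A \<noteq> 0"
  shows "A * right_inv = 1\<^sub>m n"
proof (rule eq_matI)
  fix k i assume "k < dim_row (1\<^sub>m n :: coquat mat)" "i < dim_col (1\<^sub>m n :: coquat mat)"
  then have ki: "k < n" "i < n" by simp_all
  let ?c = "of_real (1 / hermitian_det A) :: coquat"
  have "(A * right_inv) $$ (k, i) = (\<Sum>j<n. A $$ (k, j) * (?c * right_cofactor A i j))"
    using A ki by (simp add: right_inv_def scalar_prod_def atLeast0LessThan)
  \<comment> \<open>The scalar is real and therefore commutes with the entry on its left.\<close>
  also have "\<dots> = (\<Sum>j<n. ?c * (A $$ (k, j) * right_cofactor A i j))"
    by (simp only: mult.assoc[symmetric] coquat_real_commute[OF Reals_of_real, of _ "A $$ _"])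
  also have "\<dots> = (1\<^sub>m n) $$ (k, i)"
    using assms ki unfolding sum_distrib_left[symmetric] sum_row_right_cofactor[OF ki(2,1)]
    by (simp flip: of_real_mult)
  finally show "(A * right_inv) $$ (k, i) = (1\<^sub>m n) $$ (k, i)" .
qed (use A inv_carrier in auto)

lemma left_inv_mult:
  assumes "hermitian_det A \<noteq> 0"
  shows "left_inv * A = 1\<^sub>m n"
proof (rule eq_matI)
  fix i k assume "i < dim_row (1\<^sub>m n :: coquat mat)" "k < dim_col (1\<^sub>m n :: coquat mat)"
  then have ki: "k < n" "i < n" by simp_all
  let ?c = "of_real (1 / hermitian_det A) :: coquat"
  have "(left_inv * A) $$ (i, k) = (\<Sum>j<n. ?c * left_cofactor A j i * A $$ (j, k))"
    using A ki by (simp add: left_inv_def scalar_prod_def atLeast0LessThan)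
  also have "\<dots> = (1\<^sub>m n) $$ (i, k)"
    using assms ki unfolding mult.assoc sum_distrib_left[symmetric] sum_left_cofactor_col[OF ki(2,1)]
    by (simp flip: of_real_mult)
  finally show "(left_inv * A) $$ (i, k) = (1\<^sub>m n) $$ (i, k)" .
qed (use A inv_carrier in auto)

end

theorem theorem4p1:
  fixes A :: "coquat mat" and n :: nat
  assumes n: "n \<ge> 1"
    and A: "A \<in> carrier_mat n n"
    and herm: "coquat_hermitian A"
    and det: "hermitian_det A \<noteq> 0"
  shows "(\<exists>!X. X \<in> carrier_mat n n \<and> A * X = 1\<^sub>m n)
    \<and> (\<exists>!Y. Y \<in> carrier_mat n n \<and> Y * A = 1\<^sub>m n)
    \<and> (\<forall>X Y. X \<in> carrier_mat n n \<and> A * X = 1\<^sub>m n \<longrightarrow>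
             Y \<in> carrier_mat n n \<and> Y * A = 1\<^sub>m n \<longrightarrow>
             X = Y
           \<and> X = of_real (1 / hermitian_det A) \<cdot>\<^sub>m mat n n (\<lambda>(i, j). right_cofactor A j i)
           \<and> Y = of_real (1 / hermitian_det A) \<cdot>\<^sub>m mat n n (\<lambda>(i, j). left_cofactor A j i))
    \<and> (n \<ge> 2 \<longrightarrow>
        (\<forall>i<n. \<forall>j<n. i \<noteq> j \<longrightarrow>
             right_cofactor A i j =
               - rdet (delete_pos i j) (mat_delete (replace_col A (col A i) j) i i)
           \<and> left_cofactor A i j =
               - cdet (delete_pos j i) (mat_delete (replace_row A (row A j) i) j j))
      \<and> (\<forall>i<n.
             right_cofactor A i i =
               rdet (delete_pos i (Min ({0..<n} - {i}))) (mat_delete A i i)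
           \<and> left_cofactor A i i =
               cdet (delete_pos i (Min ({0..<n} - {i}))) (mat_delete A i i)))"
proof -
  interpret hermitian_coquat_mat A n using n A herm by unfold_locales
  \<comment> \<open>Associativity identifies any right inverse with any left inverse; the existence
    of one of each then gives both uniqueness claims.\<close>
  have eq: "X = Y" if "X \<in> carrier_mat n n" "A * X = 1\<^sub>m n" "Y \<in> carrier_mat n n" "Y * A = 1\<^sub>m n" for X Y
  proof -
    have "Y = Y * (A * X)" using that by simp
    also have "\<dots> = Y * A * X" using that A by (intro assoc_mult_mat[symmetric]) auto
    finally show ?thesis using that by simp
  qed
  note R = inv_carrier(1) mult_right_inv[OF det] and L = inv_carrier(2) left_inv_mult[OF det]
  have X: "X = right_inv" if "X \<in> carrier_mat n n" "A * X = 1\<^sub>m n" for X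
    using eq[OF that L] eq[OF R L] by simp
  have Y: "Y = left_inv" if "Y \<in> carrier_mat n n" "Y * A = 1\<^sub>m n" for Y
    using eq[OF R that] eq[OF R L] by simp
  have "\<exists>!X. X \<in> carrier_mat n n \<and> A * X = 1\<^sub>m n" "\<exists>!Y. Y \<in> carrier_mat n n \<and> Y * A = 1\<^sub>m n"
    using R L X Y by blast+
  moreover have "\<forall>X Y. X \<in> carrier_mat n n \<and> A * X = 1\<^sub>m n \<longrightarrow>
      Y \<in> carrier_mat n n \<and> Y * A = 1\<^sub>m n \<longrightarrow> X = Y \<and> X = right_inv \<and> Y = left_inv"
    using eq X Y by blast
  ultimately show ?thesis
    unfolding right_inv_def left_inv_def
    by (intro conjI allI impI right_cofactor_off_diag_rdet[OF A] left_cofactor_off_diag_cdet[OF A]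
      right_cofactor_diag_rdet[OF A] left_cofactor_diag_cdet[OF A]; simp?)
qed

end
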